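(* Fix $v\in\mathbb R$, $a\in(0,2]$, $p\in\mathbb N$ and real numbers $q_1^0,\dots,q_p^0$, all nonzero. For $t>1$ let $J_t$ be the operator $J$ with perturbation $q_j=tq_j^0$ ($1\le j\le p$), $q_j=0$ ($j>p$). Then every state of $J_t$ whose projection stays bounded converges to $(-1)^pv$ as $t\to\infty$: precisely, for every $R>0$ and $\varepsilon>0$ there is $t_0$ such that for all $t>t_0$ every state $\lambda$ of $J_t$ with $|\pi(\lambda)|\le R$ satisfies $|\pi(\lambda)-(-1)^pv|<\varepsilon$. (Consequently the same holds for the states of the half-nanotube Hamiltonian $H^b$, which is unitarily equivalent to a direct sum of such operators with $a=2|\cos(b+\pi k/N)|$, $k\in\mathbb Z_N$, all nonzero.)
   Context: Put $a_n=a$ for even $n\ge0$, $a_n=1$ for odd $n\ge1$; $v_n=v$ for odd $n$, $v_n=-v$ for even $n$; $\tilde v_n=v_n+q_n$. $J$ is the Jacobi operator on $\ell^2(\mathbb N)$: $(Jy)_1=a_1y_2+\tilde v_1y_1$, $(Jy)_n=a_{n-1}y_{n-1}+a_ny_{n+1}+\tilde v_ny_n$ ($n\ge2$). Band edges $\lambda_0^\pm=\mp\sqrt{v^2+(a+1)^2}$, $\lambda_1^\pm=\pm\sqrt{v^2+(a-1)^2}$; $\sigma_{ac}=[\lambda_0^+,\lambda_1^-]\cup[\lambda_1^+,\lambda_0^-]$. $\Lambda$ is the two-sheeted Riemann surface obtained by gluing two copies $\Lambda_+$ (physical sheet) and $\Lambda_-$ of $\mathbb C\setminus\sigma_{ac}$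 crosswise along the bands, $\pi:\Lambda\to\mathbb C$ the projection. For $\lambda\in\Lambda_+$, $R(\lambda)=(J-\lambda)^{-1}$; for finitely supported $f,g$, $\langle R(\lambda)f,g\rangle$ extends meromorphically to $\Lambda$. A state is: an eigenvalue of $J$ (bound state), or a point of $\Lambda_-$ where $\langle Rf,g\rangle$ has a pole for some finitely supported $f,g$ (resonance), or a band edge where $\langle Rf,g\rangle$ is singular for some finitely supported $f,g$ (virtual state). *)

theory Defs
  imports "HOL-Analysis.Analysis"
begin

definition acoef :: "real \<Rightarrow> nat \<Rightarrow> real" where
  "acoef a n = (if even n then a else 1)"

definition vcoef :: "real \<Rightarrow> nat \<Rightarrow> real" where
  "vcoef v n = (if odd n then v else - v)"

text \<open>Vectors of l2(N) are functions on nat, indexed from 1; the entry 0 is forced to be 0.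
  The Jacobi operator J with diagonal perturbation q acts by
  (Jy)_n = a_(n-1) y_(n-1) + a_n y_(n+1) + (v_n + q_n) y_n, n >= 1, with y_0 = 0.\<close>
definition jac_apply :: "real \<Rightarrow> real \<Rightarrow> (nat \<Rightarrow> real) \<Rightarrow> (nat \<Rightarrow> complex) \<Rightarrow> nat \<Rightarrow> complex" where
  "jac_apply a v q y n =
     (if n = 0 then 0 else
        (if n = 1 then 0 else complex_of_real (acoef a (n - 1)) * y (n - 1))
        + complex_of_real (acoef a n) * y (n + 1)
        + complex_of_real (vcoef v n + q n) * y n)"

definition l2_vec :: "(nat \<Rightarrow> complex) \<Rightarrow> bool" where
  "l2_vec y \<longleftrightarrow> y 0 = 0 \<and> summable (\<lambda>n. (cmod (y n))^2)"

definition fin_supp :: "(nat \<Rightarrow> complex) \<Rightarrow> bool" where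
  "fin_supp f \<longleftrightarrow> f 0 = 0 \<and> finite {n. f n \<noteq> 0}"

definition eigenvalue_J :: "real \<Rightarrow> real \<Rightarrow> (nat \<Rightarrow> real) \<Rightarrow> complex \<Rightarrow> bool" where
  "eigenvalue_J a v q \<mu> \<longleftrightarrow>
     (\<exists>y. l2_vec y \<and> y \<noteq> (\<lambda>_. 0) \<and> (\<forall>n\<ge>1. jac_apply a v q y n = \<mu> * y n))"

text \<open>Matrix element of the resolvent on the physical sheet:
  R(lambda) f is the unique l2 solution y of (J - lambda) y = f (defined off the spectrum),
  and the form is sum_n y_n * conj(g_n).\<close>
definition resolvent_form ::
  "real \<Rightarrow> real \<Rightarrow> (nat \<Rightarrow> real) \<Rightarrow> (nat \<Rightarrow> complex) \<Rightarrow> (nat \<Rightarrow> complex) \<Rightarrow> complex \<Rightarrow> complex" where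
  "resolvent_form a v q f g z =
     (if (\<exists>!y. l2_vec y \<and> (\<forall>n\<ge>1. jac_apply a v q y n - z * y n = f n))
      then (let y = (THE y. l2_vec y \<and> (\<forall>n\<ge>1. jac_apply a v q y n - z * y n = f n))
            in \<Sum>n\<in>{n. g n \<noteq> 0}. y n * cnj (g n))
      else 0)"

definition lam0p :: "real \<Rightarrow> real \<Rightarrow> real" where "lam0p a v = - sqrt (v^2 + (a + 1)^2)"
definition lam0m :: "real \<Rightarrow> real \<Rightarrow> real" where "lam0m a v = sqrt (v^2 + (a + 1)^2)"
definition lam1p :: "real \<Rightarrow> real \<Rightarrow> real" where "lam1p a v = sqrt (v^2 + (a - 1)^2)"
definition lam1m :: "real \<Rightarrow> real \<Rightarrow> real" where "lam1m a v = - sqrt (v^2 + (a - 1)^2)"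

definition sigma_ac :: "real \<Rightarrow> real \<Rightarrow> complex set" where
  "sigma_ac a v = complex_of_real ` ({lam0p a v .. lam1m a v} \<union> {lam1p a v .. lam0m a v})"

definition band_edges :: "real \<Rightarrow> real \<Rightarrow> complex set" where
  "band_edges a v = complex_of_real ` {lam0p a v, lam1m a v, lam1p a v, lam0m a v}"

definition mero_on :: "complex set \<Rightarrow> (complex \<Rightarrow> complex) \<Rightarrow> bool" where
  "mero_on S G \<longleftrightarrow> (\<exists>P. P \<subseteq> S \<and> (\<forall>z\<in>S. \<not> z islimpt P) \<and> G holomorphic_on (S - P)
                        \<and> (\<forall>z\<in>P. filterlim G at_infinity (at z)))"

text \<open>G is the restriction to the unphysical sheet Lambda_- of the meromorphic continuation of
  F (given on the physical sheet Lambda_+) to the Riemann surface obtained by gluing the sheets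
  crosswise along the bands: near each interior band point, the upper half of Lambda_+ continues
  into the lower half of Lambda_- and vice versa.\<close>
definition cross_glued :: "complex \<Rightarrow> (complex \<Rightarrow> complex) \<Rightarrow> (complex \<Rightarrow> complex) \<Rightarrow> bool" where
  "cross_glued \<mu> F G \<longleftrightarrow>
     (\<exists>r>0. \<exists>h P. P \<subseteq> ball \<mu> r \<and> (\<forall>z\<in>ball \<mu> r. \<not> z islimpt P) \<and>
        h holomorphic_on (ball \<mu> r - P) \<and>
        (\<forall>z\<in>ball \<mu> r - P. (Im z > 0 \<longrightarrow> h z = F z) \<and> (Im z < 0 \<longrightarrow> h z = G z)))"

definition second_sheet_cont ::
  "real \<Rightarrow> real \<Rightarrow> (nat \<Rightarrow> real) \<Rightarrow> (nat \<Rightarrow> complex) \<Rightarrow> (nat \<Rightarrow> complex) \<Rightarrow> (complex \<Rightarrow> complex) \<Rightarrow> bool" where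
  "second_sheet_cont a v q f g G \<longleftrightarrow>
     mero_on (- sigma_ac a v) G \<and>
     (\<forall>\<mu>\<in>sigma_ac a v - band_edges a v.
        cross_glued \<mu> (resolvent_form a v q f g) G \<and> cross_glued \<mu> G (resolvent_form a v q f g))"

definition resonance :: "real \<Rightarrow> real \<Rightarrow> (nat \<Rightarrow> real) \<Rightarrow> complex \<Rightarrow> bool" where
  "resonance a v q \<mu> \<longleftrightarrow> \<mu> \<notin> sigma_ac a v \<and>
     (\<exists>f g G. fin_supp f \<and> fin_supp g \<and> second_sheet_cont a v q f g G \<and>
              filterlim G at_infinity (at \<mu>))"

text \<open>Virtual state: a band edge where some matrix element of the resolvent is singular, i.e.
  not bounded near the edge on the physical sheet (away from eigenvalues).\<close>
definition virtual_state :: "real \<Rightarrow> real \<Rightarrow> (nat \<Rightarrow> real) \<Rightarrow> complex \<Rightarrow> bool" where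
  "virtual_state a v q \<mu> \<longleftrightarrow> \<mu> \<in> band_edges a v \<and>
     (\<exists>f g. fin_supp f \<and> fin_supp g \<and>
        \<not> (\<exists>r>0. \<exists>B. \<forall>z\<in>ball \<mu> r - sigma_ac a v. \<not> eigenvalue_J a v q z \<longrightarrow>
                 cmod (resolvent_form a v q f g z) \<le> B))"

definition state_proj :: "real \<Rightarrow> real \<Rightarrow> (nat \<Rightarrow> real) \<Rightarrow> complex \<Rightarrow> bool" where
  "state_proj a v q \<mu> \<longleftrightarrow> eigenvalue_J a v q \<mu> \<or> resonance a v q \<mu> \<or> virtual_state a v q \<mu>"

definition pert :: "nat \<Rightarrow> (nat \<Rightarrow> real) \<Rightarrow> real \<Rightarrow> nat \<Rightarrow> real" where
  "pert p q0 t j = (if 1 \<le> j \<and> j \<le> p then t * q0 j else 0)"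

end

theory Submission
  imports Defs "HOL-Complex_Analysis.Complex_Analysis"
begin

text \<open>For a Floquet multiplier \<open>\<theta>\<close> of the unperturbed period-two recurrence, let \<open>\<psi>\<close> be the solution
  of \<open>J y = z y\<close> that coincides with the Floquet solution beyond the perturbed sites. The resolvent is
  \<open>- \<phi>\<^sub>m \<psi>\<^sub>n / (a \<psi>\<^sub>0)\<close> with \<open>\<phi>\<close> the solution vanishing at 0, where \<open>\<bar>\<theta>\<bar> < 1\<close> on the physical sheet and
  \<open>\<theta>\<close> is replaced by \<open>1 / \<theta>\<close> on the other one. Hence a state at \<open>z\<close> forces the Jost function \<open>\<psi>\<^sub>0\<close> to
  vanish there (or to come close to zero nearby, for a virtual state) for one of the two multipliers.
  Normalise \<open>\<psi>\<^sub>p = z - (-1)\<^sup>p v\<close> and \<open>\<psi>\<^sub>p\<^sub>+\<^sub>1 = a\<^sub>p + a\<^sub>p\<^sub>+\<^sub>1 \<theta>\<close>. When \<open>\<bar>q\<^sub>j\<bar>\<close> is large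
  for all \<open>j \<le> p\<close>, the recurrence gives \<open>\<bar>\<psi>\<^sub>p\<bar> \<le> \<bar>\<psi>\<^sub>p\<^sub>-\<^sub>1\<bar> \<le> \<dots> \<le> \<bar>\<psi>\<^sub>0\<bar>\<close>, uniformly in
  bounded \<open>z\<close> away from \<open>(-1)\<^sup>p v\<close> and in both multipliers, so no state lies there.\<close>

section \<open>Jost solutions\<close>

lemma geometric_tail_bounded:
  fixes y :: "nat \<Rightarrow> complex"
  assumes "\<And>n. n \<ge> M \<Longrightarrow> y (Suc (Suc n)) = \<theta> * y n" and "norm \<theta> \<le> 1"
  shows "bounded (range y)"
proof -
  define C where "C = max (norm (y M)) (norm (y (Suc M)))"
  have "norm (y (M + k)) \<le> C" for k
  proof (induction k rule: less_induct)
    case (less k)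
    consider "k = 0" | "k = 1" | j where "k = Suc (Suc j)"
      by (metis One_nat_def not0_implies_Suc)
    then show ?case
    proof cases
      case 3
      then have "norm (y (M + k)) = norm \<theta> * norm (y (M + j))"
        using assms(1)[of "M + j"] by (simp add: norm_mult)
      also have "\<dots> \<le> 1 * norm (y (M + j))"
        by (intro mult_right_mono assms) simp
      also have "\<dots> \<le> C" using less 3 by simp
      finally show ?thesis .
    qed (simp_all add: C_def)
  qed
  then have *: "norm (y n) \<le> C" if "n \<ge> M" for n
    using that by (metis le_Suc_ex)
  have "range y \<subseteq> y ` {..<M} \<union> cball 0 C"
  proof
    fix x assume "x \<in> range y"
    then obtain n where "x = y n" by blast
    then show "x \<in> y ` {..<M} \<union> cball 0 C"
      using *[of n] by (cases "n < M") auto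
  qed
  then show ?thesis
    by (rule bounded_subset[rotated]) (auto intro: finite_imp_bounded)
qed

lemma geometric_tail_summable:
  fixes y :: "nat \<Rightarrow> complex"
  assumes tail: "\<And>n. n \<ge> M \<Longrightarrow> y (Suc (Suc n)) = \<theta> * y n"
    and "\<theta> \<noteq> 0" and "norm \<theta> < 1"
  shows "summable (\<lambda>n. (norm (y n))\<^sup>2)"
proof -
  \<comment> \<open>Two sites cost a factor \<open>norm \<theta>\<close>, so \<open>r\<close> is the
    decay rate per site. The constant \<open>C\<close> fits \<open>C * r ^ n\<close> to the first
    even and odd steps, and \<open>\<theta> \<noteq> 0\<close> makes its divisors nonzero.\<close>
  define r where "r = sqrt (norm \<theta>)"
  have r: "r > 0" "r < 1" "r\<^sup>2 = norm \<theta>"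
    using assms by (auto simp: r_def)
  define C where "C = max (norm (y M) / r ^ M) (norm (y (Suc M)) / r ^ Suc M)"
  have "norm (y (M + k)) \<le> C * r ^ (M + k)" for k
  proof (induction k rule: less_induct)
    case (less k)
    consider "k = 0" | "k = 1" | j where "k = Suc (Suc j)"
      by (metis One_nat_def not0_implies_Suc)
    then show ?case
    proof cases
      case 1
      have "norm (y M) / r ^ M \<le> C" by (simp add: C_def)
      then show ?thesis using 1 r by (simp add: field_simps)
    next
      case 2
      have "norm (y (Suc M)) / r ^ Suc M \<le> C" by (simp add: C_def)
      then show ?thesis using 2 r by (simp add: field_simps)
    next
      case 3
      then have "norm (y (M + k)) = r\<^sup>2 * norm (y (M + j))"
        using tail[of "M + j"] by (simp add: norm_mult r)
      also have "\<dots> \<le> r\<^sup>2 * (C * r ^ (M + j))"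
        using less 3 by (intro mult_left_mono) auto
      finally show ?thesis using 3 by (simp add: power2_eq_square mult_ac)
    qed
  qed
  then have *: "norm (y n) \<le> C * r ^ n" if "n \<ge> M" for n
    using that by (metis le_Suc_ex)
  have "summable (\<lambda>n. C\<^sup>2 * (r\<^sup>2) ^ n)"
    using r assms(3) by (intro summable_mult summable_geometric) auto
  then show ?thesis
  proof (rule summable_comparison_test'[where N = M])
    fix n assume "n \<ge> M"
    then have "(norm (y n))\<^sup>2 \<le> (C * r ^ n)\<^sup>2" by (intro power_mono *) auto
    then show "norm ((norm (y n))\<^sup>2) \<le> C\<^sup>2 * (r\<^sup>2) ^ n"
      by (simp add: power_mult_distrib power_mult[symmetric] mult.commute)
  qed
qed

lemma l2_vec_tendsto_0:
  assumes "l2_vec y"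
  shows "y \<longlonglongrightarrow> 0"
proof -
  have "(\<lambda>n. (norm (y n))\<^sup>2) \<longlonglongrightarrow> 0"
    using assms unfolding l2_vec_def by (blast intro: summable_LIMSEQ_zero)
  then have "(\<lambda>n. sqrt ((norm (y n))\<^sup>2)) \<longlonglongrightarrow> sqrt 0"
    by (rule tendsto_real_sqrt)
  then show ?thesis by (simp add: tendsto_norm_zero_cancel)
qed

section \<open>Solutions of the perturbed recurrence and their Wronskian\<close>

locale perturbed_jacobi =
  fixes a v :: real and p :: nat and q :: "nat \<Rightarrow> real"
  assumes a_pos: "a > 0" and q_tail: "n > p \<Longrightarrow> q n = 0"
begin

abbreviation c :: "nat \<Rightarrow> complex" where
  "c n \<equiv> complex_of_real (acoef a n)"

abbreviation d :: "nat \<Rightarrow> complex" where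
  "d n \<equiv> complex_of_real (vcoef v n + q n)"

lemma acoef_nonzero [simp]: "acoef a n \<noteq> 0"
  using a_pos by (simp add: acoef_def)

lemma norm_c_le: "norm (c n) \<le> 1 + a"
  using a_pos by (simp add: acoef_def)

text \<open>Unlike in \<open>jac_apply\<close>, the value at 0 is free and is coupled to site 1
  through \<open>c 0\<close>. This admits solutions that do not vanish at 0, such as the Jost
  solution.\<close>

definition solves :: "complex \<Rightarrow> (nat \<Rightarrow> complex) \<Rightarrow> bool" where
  "solves z y \<longleftrightarrow>
     (\<forall>n. c n * y n + c (Suc n) * y (Suc (Suc n)) + d (Suc n) * y (Suc n) = z * y (Suc n))"

lemma jac_apply_Suc:
  assumes "y 0 = 0"
  shows "jac_apply a v q y (Suc n) = c n * y n + c (Suc n) * y (Suc (Suc n)) + d (Suc n) * y (Suc n)"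
  using assms by (simp add: jac_apply_def)

lemma jac_apply_eq_iff_solves:
  assumes "y 0 = 0"
  shows "(\<forall>n\<ge>1. jac_apply a v q y n = z * y n) \<longleftrightarrow> solves z y"
  unfolding solves_def jac_apply_Suc[where y = y, OF assms, symmetric]
  by (metis One_nat_def Suc_le_D Suc_le_mono le0)

lemma wronskian_constant:
  assumes "solves z y" "solves z w"
  shows "c n * (y n * w (Suc n) - y (Suc n) * w n) = c 0 * (y 0 * w 1 - y 1 * w 0)"
proof (induction n)
  case (Suc n)
  have y: "c (Suc n) * y (Suc (Suc n)) = (z - d (Suc n)) * y (Suc n) - c n * y n"
    using assms(1)[unfolded solves_def, rule_format, of n] by (simp add: algebra_simps)
  have w: "c (Suc n) * w (Suc (Suc n)) = (z - d (Suc n)) * w (Suc n) - c n * w n"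
    using assms(2)[unfolded solves_def, rule_format, of n] by (simp add: algebra_simps)
  have "c (Suc n) * (y (Suc n) * w (Suc (Suc n)) - y (Suc (Suc n)) * w (Suc n)) =
        y (Suc n) * (c (Suc n) * w (Suc (Suc n))) - (c (Suc n) * y (Suc (Suc n))) * w (Suc n)"
    by (simp add: algebra_simps)
  also have "\<dots> = c n * (y n * w (Suc n) - y (Suc n) * w n)"
    unfolding y w by (simp add: algebra_simps)
  finally show ?case using Suc by simp
qed simp

text \<open>The Wronskian of a decaying and a bounded solution tends to 0, and being constant it is
  0. At site 0 it equals \<open>- c 0 * y 1 * w 0\<close>, so \<open>y 1 = 0\<close>, and the
  recurrence then kills \<open>y\<close>.\<close>

lemma decaying_solution_zero:
  assumes y: "solves z y" "y 0 = 0" "y \<longlonglongrightarrow> 0"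
    and w: "solves z w" "bounded (range w)" "w 0 \<noteq> 0"
  shows "y = (\<lambda>_. 0)"
proof -
  obtain B where B: "\<And>n. norm (w n) \<le> B" using w(2) by (auto simp: bounded_iff)
  have null: "(\<lambda>n. c n * w (g n) * x n) \<longlonglongrightarrow> 0" if "x \<longlonglongrightarrow> 0" for x :: "nat \<Rightarrow> complex" and g
  proof (rule Lim_null_comparison)
    show "\<forall>\<^sub>F n in sequentially. norm (c n * w (g n) * x n) \<le> (1 + a) * B * norm (x n)"
      unfolding norm_mult by (intro always_eventually allI mult_right_mono mult_mono norm_c_le B) (use a_pos in auto)
    show "(\<lambda>n. (1 + a) * B * norm (x n)) \<longlonglongrightarrow> 0"
      using tendsto_mult_left[OF tendsto_norm_zero[OF that], of "(1 + a) * B"] by simp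
  qed
  have "(\<lambda>n. c n * w (Suc n) * y n) \<longlonglongrightarrow> 0" "(\<lambda>n. c n * w n * y (Suc n)) \<longlonglongrightarrow> 0"
    by (rule null y(3) LIMSEQ_Suc)+
  then have "(\<lambda>n. c n * w (Suc n) * y n - c n * w n * y (Suc n)) \<longlonglongrightarrow> 0 - 0"
    by (rule tendsto_diff)
  moreover have "c n * w (Suc n) * y n - c n * w n * y (Suc n) = - (c 0 * y 1 * w 0)" for n
    using wronskian_constant[OF y(1) w(1), of n] y(2) by (simp add: algebra_simps)
  ultimately have "(\<lambda>n::nat. - (c 0 * y 1 * w 0)) \<longlonglongrightarrow> 0" by simp
  then have "y 1 = 0" using w(3) by (simp add: LIMSEQ_const_iff)
  then have "y n = 0 \<and> y (Suc n) = 0" for n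
  proof (induction n)
    case (Suc n)
    then have "c (Suc n) * y (Suc (Suc n)) = 0"
      using y(1)[unfolded solves_def, rule_format, of n] by simp
    then show ?case using Suc by simp
  qed (use y in simp)
  then show ?thesis by auto
qed

text \<open>\<open>\<theta>\<close> is a Floquet multiplier of the unperturbed period-two recurrence; the two roots
  of this quadratic equation have product 1.\<close>
definition floquet :: "complex \<Rightarrow> complex \<Rightarrow> bool" where
  "floquet z \<theta> \<longleftrightarrow> (1 + complex_of_real a * \<theta>) * (complex_of_real a + \<theta>) = \<theta> * (z\<^sup>2 - (complex_of_real v)\<^sup>2)"

lemma floquet_nonzero: "floquet z \<theta> \<Longrightarrow> \<theta> \<noteq> 0"
  using a_pos by (auto simp: floquet_def)

lemma floquet_inverse:
  assumes "floquet z \<theta>"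
  shows "floquet z (inverse \<theta>)"
proof -
  have nz: "\<theta> \<noteq> 0" using assms by (rule floquet_nonzero)
  have "(1 + complex_of_real a * inverse \<theta>) * (complex_of_real a + inverse \<theta>)
    = (inverse \<theta>)\<^sup>2 * ((1 + complex_of_real a * \<theta>) * (complex_of_real a + \<theta>))"
    using nz by (simp add: field_simps power2_eq_square)
  also have "\<dots> = (inverse \<theta>)\<^sup>2 * (\<theta> * (z\<^sup>2 - (complex_of_real v)\<^sup>2))"
    using assms unfolding floquet_def by simp
  also have "\<dots> = inverse \<theta> * (z\<^sup>2 - (complex_of_real v)\<^sup>2)"
    using nz by (simp add: power2_eq_square)
  finally show ?thesis unfolding floquet_def .
qed

definition floquet_bound :: "real \<Rightarrow> real" where
  "floquet_bound R = (R\<^sup>2 + v\<^sup>2 + 1 + a\<^sup>2) / a + 1"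

text \<open>For \<open>norm \<theta> > 1\<close>, solve the quadratic for
  \<open>a * \<theta>\<^sup>2\<close> and divide by \<open>norm \<theta>\<close>. The larger root is
  bounded as well, so one constant serves both sheets.\<close>

lemma norm_floquet_le:
  assumes "floquet z \<theta>" "norm z \<le> R"
  shows "norm \<theta> \<le> floquet_bound R"
proof (cases "norm \<theta> \<le> 1")
  case True
  then show ?thesis using a_pos by (simp add: floquet_bound_def add_increasing)
next
  case False
  have "complex_of_real a * \<theta>\<^sup>2 = \<theta> * (z\<^sup>2 - (complex_of_real v)\<^sup>2 - 1 - (complex_of_real a)\<^sup>2) - complex_of_real a"
    using assms(1) unfolding floquet_def by (simp add: algebra_simps power2_eq_square)
  then have "a * (norm \<theta>)\<^sup>2 = norm (\<theta> * (z\<^sup>2 - (complex_of_real v)\<^sup>2 - 1 - (complex_of_real a)\<^sup>2) - complex_of_real a)"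
    using a_pos by (simp only: norm_mult norm_power norm_of_real abs_of_pos flip: \<open>_ = _ - complex_of_real a\<close>)
  also have "\<dots> \<le> norm \<theta> * norm (z\<^sup>2 - (complex_of_real v)\<^sup>2 - 1 - (complex_of_real a)\<^sup>2) + a"
    using norm_triangle_ineq4[of "\<theta> * (z\<^sup>2 - (complex_of_real v)\<^sup>2 - 1 - (complex_of_real a)\<^sup>2)" "complex_of_real a"] a_pos by (simp add: norm_mult)
  also have "\<dots> \<le> norm \<theta> * (R\<^sup>2 + v\<^sup>2 + 1 + a\<^sup>2) + a * norm \<theta>"
  proof (intro add_mono mult_left_mono)
    have "norm (z\<^sup>2 - (complex_of_real v)\<^sup>2 - 1 - (complex_of_real a)\<^sup>2) \<le> norm (z\<^sup>2) + norm ((complex_of_real v)\<^sup>2) + norm (1::complex) + norm ((complex_of_real a)\<^sup>2)"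
      by (intro order_trans[OF norm_triangle_ineq4] add_mono order_refl)
    also have "\<dots> \<le> R\<^sup>2 + v\<^sup>2 + 1 + a\<^sup>2"
      using assms(2) by (simp add: norm_power power_mono del: of_real_power)
    finally show "norm (z\<^sup>2 - (complex_of_real v)\<^sup>2 - 1 - (complex_of_real a)\<^sup>2) \<le> R\<^sup>2 + v\<^sup>2 + 1 + a\<^sup>2" .
  qed (use False a_pos in auto)
  finally have "norm \<theta> * (a * norm \<theta>) \<le> norm \<theta> * (R\<^sup>2 + v\<^sup>2 + 1 + a\<^sup>2 + a)"
    by (simp add: algebra_simps power2_eq_square)
  then have "a * norm \<theta> \<le> R\<^sup>2 + v\<^sup>2 + 1 + a\<^sup>2 + a"
    using False by (subst (asm) mult_le_cancel_left_pos) auto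
  then show ?thesis using a_pos by (simp add: floquet_bound_def field_simps)
qed

text \<open>The Jost solution, normalised to be polynomial in \<open>z\<close> and \<open>\<theta>\<close>: an explicit Floquet solution
  from site \<open>p\<close> on, continued to the sites below \<open>p\<close> by the perturbed recurrence.\<close>
function jost :: "complex \<Rightarrow> complex \<Rightarrow> nat \<Rightarrow> complex" where
  "jost z \<theta> n =
     (if p \<le> n
      then \<theta> ^ ((n - p) div 2) * (if even (n - p) then z - vcoef v (Suc p) else c p + c (Suc p) * \<theta>)
      else ((z - d (Suc n)) * jost z \<theta> (Suc n) - c (Suc n) * jost z \<theta> (Suc (Suc n))) / c n)"
  by auto
termination by (relation "Wellfounded.measure (\<lambda>(z, \<theta>, n). p - n)") auto

declare jost.simps [simp del]

lemma jost_p: "jost z \<theta> p = z - vcoef v (Suc p)"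
  by (simp add: jost.simps)

lemma jost_Suc_p: "jost z \<theta> (Suc p) = c p + c (Suc p) * \<theta>"
  by (simp add: jost.simps)

lemma jost_tail: "p \<le> n \<Longrightarrow> jost z \<theta> (Suc (Suc n)) = \<theta> * jost z \<theta> n"
  by (simp add: jost.simps Suc_diff_le)

text \<open>Below \<open>p\<close> this is the defining recursion. Beyond \<open>p\<close>, at even
  offset the normalisation makes the equation an identity; at odd offset it reduces to the Floquet
  equation.\<close>

lemma solves_jost:
  assumes "floquet z \<theta>"
  shows "solves z (jost z \<theta>)"
  unfolding solves_def
proof
  fix n
  show "c n * jost z \<theta> n + c (Suc n) * jost z \<theta> (Suc (Suc n)) + d (Suc n) * jost z \<theta> (Suc n)
    = z * jost z \<theta> (Suc n)"
  proof (cases "p \<le> n")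
    case False
    then have "c n * jost z \<theta> n = (z - d (Suc n)) * jost z \<theta> (Suc n) - c (Suc n) * jost z \<theta> (Suc (Suc n))"
      by (subst jost.simps) simp
    then show ?thesis by (simp add: algebra_simps)
  next
    case True
    then obtain k where n: "n = p + k" by (metis le_Suc_ex)
    have q: "q (Suc n) = 0" using True q_tail by simp
    \<comment> \<open>The numbers \<open>c p\<close> and \<open>c (Suc p)\<close> are 1 and
      \<open>a\<close> in an order fixed by the parity of \<open>p\<close>. The left side of the
      Floquet equation is the same for either order.\<close>
    have fl: "(c p + c (Suc p) * \<theta>) * (c (Suc p) + c p * \<theta>) = \<theta> * (z\<^sup>2 - (complex_of_real v)\<^sup>2)"
      using assms unfolding floquet_def by (simp add: acoef_def algebra_simps)
    define s where "s = complex_of_real (vcoef v (Suc p))"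
    have s2: "s\<^sup>2 = (complex_of_real v)\<^sup>2" by (simp add: s_def vcoef_def)
    show ?thesis
    proof (cases "even k")
      case True
      then obtain j where k: "k = 2 * j" by auto
      have "c n = c p" "c (Suc n) = c (Suc p)" "d (Suc n) = s"
        using k n q by (simp_all add: acoef_def vcoef_def s_def)
      moreover have "jost z \<theta> n = \<theta> ^ j * (z - s)" "jost z \<theta> (Suc n) = \<theta> ^ j * (c p + c (Suc p) * \<theta>)"
        "jost z \<theta> (Suc (Suc n)) = \<theta> ^ Suc j * (z - s)"
        using k n by (simp_all add: jost.simps s_def)
      ultimately show ?thesis by (simp only: power_Suc) (simp add: algebra_simps)
    next
      case False
      then obtain j where k: "k = Suc (2 * j)" by (auto elim: oddE)
      have cd: "c n = c (Suc p)" "c (Suc n) = c p" "d (Suc n) = - s"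
        using k n q by (simp_all add: acoef_def vcoef_def s_def)
      have jo: "jost z \<theta> n = \<theta> ^ j * (c p + c (Suc p) * \<theta>)"
        "jost z \<theta> (Suc n) = \<theta> ^ j * (\<theta> * (z - s))"
        "jost z \<theta> (Suc (Suc n)) = \<theta> ^ j * (\<theta> * (c p + c (Suc p) * \<theta>))"
        using k n by (simp_all add: jost.simps s_def)
      have "c (Suc p) * (\<theta> ^ j * (c p + c (Suc p) * \<theta>)) + c p * (\<theta> ^ j * (\<theta> * (c p + c (Suc p) * \<theta>)))
         = \<theta> ^ j * ((c p + c (Suc p) * \<theta>) * (c (Suc p) + c p * \<theta>))"
        by (simp add: algebra_simps)
      also have "\<dots> = \<theta> ^ j * (\<theta> * (z\<^sup>2 - s\<^sup>2))"
        unfolding fl s2 ..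
      also have "\<dots> = (z + s) * (\<theta> ^ j * (\<theta> * (z - s)))"
        by (simp add: algebra_simps power2_eq_square)
      finally show ?thesis
        unfolding cd jo by (simp add: algebra_simps)
    qed
  qed
qed

lemma holomorphic_jost:
  assumes "\<theta> holomorphic_on S"
  shows "(\<lambda>z. jost z (\<theta> z) n) holomorphic_on S"
proof (induction "p - n" arbitrary: n rule: less_induct)
  case less
  show ?case
  proof (cases "p \<le> n")
    case True
    then show ?thesis
      by (cases "even (n - p)"; subst jost.simps) (auto intro!: holomorphic_intros assms)
  next
    case False
    then have "(\<lambda>z. jost z (\<theta> z) (Suc n)) holomorphic_on S" "(\<lambda>z. jost z (\<theta> z) (Suc (Suc n))) holomorphic_on S"
      by (auto intro!: less)
    then show ?thesis using False
      by (subst jost.simps) (auto intro!: holomorphic_intros)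
  qed
qed

lemma continuous_on_jost: "continuous_on S (\<lambda>x. jost (fst x) (snd x) n)"
proof (induction "p - n" arbitrary: n rule: less_induct)
  case less
  show ?case
  proof (cases "p \<le> n")
    case True
    then show ?thesis
      by (cases "even (n - p)"; subst jost.simps) (auto intro!: continuous_intros)
  next
    case False
    then have "continuous_on S (\<lambda>x. jost (fst x) (snd x) (Suc n))"
      "continuous_on S (\<lambda>x. jost (fst x) (snd x) (Suc (Suc n)))"
      by (auto intro!: less)
    then show ?thesis using False
      by (subst jost.simps) (auto intro!: continuous_intros)
  qed
qed

text \<open>Every step down through a strongly perturbed site enlarges the Jost solution.\<close>
lemma norm_jost_0_ge:
  fixes z :: complex
  assumes z: "norm z \<le> R" "\<epsilon> \<le> norm (z - vcoef v (Suc p))" and "\<epsilon> > 0" and \<theta>: "norm \<theta> \<le> K"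
    and q: "\<And>j. 1 \<le> j \<Longrightarrow> j \<le> p \<Longrightarrow> \<bar>q j\<bar> \<ge> R + \<bar>v\<bar> + (1 + a) * (2 + (1 + a) * (1 + K) / \<epsilon>)"
  shows "\<epsilon> \<le> norm (jost z \<theta> 0)"
proof -
  \<comment> \<open>The second summand bounds the ratio of the Jost solution at \<open>Suc p\<close>
    to that at \<open>p\<close>. The 1 gives \<open>L \<ge> 1\<close>, so the ratio bound survives
    each step at which the modulus does not decrease.\<close>
  define L where "L = 1 + (1 + a) * (1 + K) / \<epsilon>"
  have K: "K \<ge> 0" using norm_ge_zero \<theta> by (rule order_trans)
  have L: "L \<ge> 1" using K a_pos \<open>\<epsilon> > 0\<close> by (simp add: L_def)
  \<comment> \<open>Downward induction from \<open>p\<close>. The ratio bound is carried along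
    because each step involves the two sites above.\<close>
  have "\<epsilon> \<le> norm (jost z \<theta> (p - k)) \<and> norm (jost z \<theta> (Suc (p - k))) \<le> L * norm (jost z \<theta> (p - k))"
    if "k \<le> p" for k
    using that
  proof (induction k)
    case 0
    have "norm (jost z \<theta> (Suc p)) \<le> norm (c p) + norm (c (Suc p)) * norm \<theta>"
      unfolding jost_Suc_p by (metis norm_mult norm_triangle_ineq)
    also have "\<dots> \<le> (1 + a) + (1 + a) * K"
      by (intro add_mono mult_mono norm_c_le \<theta>) (use a_pos in auto)
    also have "\<dots> \<le> L * \<epsilon>"
      using \<open>\<epsilon> > 0\<close> by (simp add: L_def field_simps)
    also have "\<dots> \<le> L * norm (jost z \<theta> p)"
      using z L by (simp add: jost_p mult_left_mono)
    finally show ?case using z by (simp add: jost_p)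
  next
    case (Suc k)
    define m where "m = p - Suc k"
    have m: "p - k = Suc m" "m < p" using Suc.prems by (auto simp: m_def)
    have IH: "\<epsilon> \<le> norm (jost z \<theta> (Suc m))" "norm (jost z \<theta> (Suc (Suc m))) \<le> L * norm (jost z \<theta> (Suc m))"
      using Suc m by auto
    have "c m * jost z \<theta> m = (z - d (Suc m)) * jost z \<theta> (Suc m) - c (Suc m) * jost z \<theta> (Suc (Suc m))"
      using m by (subst jost.simps) simp
    then have "norm (c m * jost z \<theta> m) \<ge>
       norm (z - d (Suc m)) * norm (jost z \<theta> (Suc m)) - norm (c (Suc m)) * norm (jost z \<theta> (Suc (Suc m)))"
      by (metis norm_mult norm_triangle_ineq2)
    moreover have "norm (c (Suc m)) * norm (jost z \<theta> (Suc (Suc m))) \<le> (1 + a) * (L * norm (jost z \<theta> (Suc m)))"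
      by (intro mult_mono norm_c_le IH) (use a_pos in auto)
    \<comment> \<open>The diagonal term gives at least \<open>(1 + a) * (1 + L)\<close> and the
      off-diagonal one takes at most \<open>(1 + a) * L\<close>. What remains, \<open>1 + a\<close>,
      compensates the factor \<open>c m\<close> on the other side.\<close>
    moreover have "norm (z - d (Suc m)) \<ge> (1 + a) * (1 + L)"
    proof -
      have "\<bar>q (Suc m)\<bar> = norm (d (Suc m) - vcoef v (Suc m))"
        by (simp add: norm_of_real[symmetric] del: norm_of_real)
      also have "\<dots> \<le> norm (d (Suc m)) + \<bar>v\<bar>"
        by (rule order_trans[OF norm_triangle_ineq4]) (simp add: vcoef_def)
      also have "norm (d (Suc m)) \<le> norm (z - d (Suc m)) + norm z"
        by (metis norm_minus_commute norm_triangle_sub add.commute)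
      finally have "\<bar>q (Suc m)\<bar> \<le> norm (z - d (Suc m)) + R + \<bar>v\<bar>" using z by simp
      moreover have "R + \<bar>v\<bar> + (1 + a) * (1 + L) \<le> \<bar>q (Suc m)\<bar>"
        using q[of "Suc m"] m by (simp add: L_def)
      ultimately show ?thesis by simp
    qed
    then have "norm (z - d (Suc m)) * norm (jost z \<theta> (Suc m)) \<ge> (1 + a) * (1 + L) * norm (jost z \<theta> (Suc m))"
      by (rule mult_right_mono) simp
    ultimately have "(1 + a) * norm (jost z \<theta> (Suc m)) \<le> norm (c m * jost z \<theta> m)"
      by (simp add: algebra_simps)
    also have "\<dots> \<le> (1 + a) * norm (jost z \<theta> m)"
      unfolding norm_mult by (intro mult_right_mono norm_c_le) simp
    finally have *: "norm (jost z \<theta> (Suc m)) \<le> norm (jost z \<theta> m)"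
      using a_pos by simp
    also have "\<dots> \<le> L * norm (jost z \<theta> m)"
      using mult_right_mono[OF L, of "norm (jost z \<theta> m)"] by simp
    finally show ?case using * IH by (simp flip: m_def)
  qed
  from this[of p] show ?thesis by simp
qed

end

section \<open>Roots of the Joukowski equation\<close>

lemma Re_csqrt_pos:
  assumes "w \<notin> \<real>\<^sub>\<le>\<^sub>0"
  shows "Re (csqrt w) > 0"
proof -
  have "Re (csqrt w) \<noteq> 0"
  proof
    assume "Re (csqrt w) = 0"
    then have "(csqrt w)\<^sup>2 \<in> \<real>\<^sub>\<le>\<^sub>0"
      by (simp add: complex_nonpos_Reals_iff power2_eq_square del: power2_csqrt csqrt.sel)
    then show False using assms by simp
  qed
  then show ?thesis using Re_csqrt[of w] by linarith
qed

text \<open>If the value were a real \<open>r \<le> 0\<close>, then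
  \<open>w\<^sup>2 = 1 / (1 - r)\<close> would lie in \<open>(0, 1]\<close>, which puts
  \<open>w\<close> on the excluded segment.\<close>

lemma one_minus_inverse_square_notin_nonpos_Reals:
  fixes w :: complex
  assumes "w \<notin> complex_of_real ` {-1..1}"
  shows "1 - 1 / w\<^sup>2 \<notin> \<real>\<^sub>\<le>\<^sub>0"
proof
  assume "1 - 1 / w\<^sup>2 \<in> \<real>\<^sub>\<le>\<^sub>0"
  then obtain r where r: "1 - 1 / w\<^sup>2 = complex_of_real r" "r \<le> 0"
    by (auto elim!: nonpos_Reals_cases)
  have "w \<noteq> 0" using assms by force
  then have w2: "w\<^sup>2 = complex_of_real (1 / (1 - r))"
    using r by (auto simp: field_simps)
  define x where "x = sqrt (1 / (1 - r))"
  have "x\<^sup>2 = 1 / (1 - r)" "0 \<le> x" "x \<le> 1"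
    using r by (auto simp: x_def)
  then have "w\<^sup>2 = (complex_of_real x)\<^sup>2" using w2 by (metis of_real_power)
  then have "w = complex_of_real x \<or> w = complex_of_real (- x)"
    by (simp add: power2_eq_iff)
  then show False using assms \<open>0 \<le> x\<close> \<open>x \<le> 1\<close> by force
qed

text \<open>This is \<open>w - sqrt (w\<^sup>2 - 1)\<close> with \<open>w\<close> pulled out of the
  root, which places the branch cut exactly on \<open>[-1, 1]\<close>.\<close>

definition small_joukowski_root :: "complex \<Rightarrow> complex" where
  "small_joukowski_root w = w * (1 - csqrt (1 - 1 / w\<^sup>2))"

text \<open>The other root is \<open>w * (1 + s)\<close> and the product of the two is 1. Since
  \<open>Re s > 0\<close>, the factor \<open>1 - s\<close> has the smaller modulus.\<close>

lemma
  assumes "w \<notin> complex_of_real ` {-1..1}"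
  shows small_joukowski_root_eq: "(small_joukowski_root w)\<^sup>2 + 1 = 2 * w * small_joukowski_root w"
    and norm_small_joukowski_root: "norm (small_joukowski_root w) < 1"
proof -
  define s where "s = csqrt (1 - 1 / w\<^sup>2)"
  have w: "w \<noteq> 0" using assms by force
  have s2: "s\<^sup>2 = 1 - 1 / w\<^sup>2" by (simp add: s_def)
  have "(w * (1 - s))\<^sup>2 + 1 - 2 * w * (w * (1 - s)) = w\<^sup>2 * s\<^sup>2 + 1 - w\<^sup>2"
    by (simp add: algebra_simps power2_eq_square)
  also have "\<dots> = 0" unfolding s2 using w by (simp add: algebra_simps)
  finally show "(small_joukowski_root w)\<^sup>2 + 1 = 2 * w * small_joukowski_root w"
    by (simp add: small_joukowski_root_def s_def)
  have "(w * (1 - s)) * (w * (1 + s)) = w\<^sup>2 * (1 - s\<^sup>2)"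
    by (simp add: algebra_simps power2_eq_square)
  also have "\<dots> = 1" unfolding s2 using w by simp
  finally have prod: "norm (w * (1 - s)) * norm (w * (1 + s)) = 1"
    by (metis norm_mult norm_one)
  have "Re s > 0"
    unfolding s_def by (intro Re_csqrt_pos one_minus_inverse_square_notin_nonpos_Reals assms)
  then have "norm (1 - s) < norm (1 + s)"
    unfolding cmod_def by (intro real_sqrt_less_mono) (simp add: power2_eq_square algebra_simps)
  then have "norm (w * (1 - s)) < norm (w * (1 + s))"
    using w by (simp add: norm_mult)
  then have "norm (w * (1 - s)) < 1"
    using prod by (smt (verit, best) mult_le_cancel_left1 norm_ge_zero mult_nonneg_nonneg mult_less_cancel_left1)
  then show "norm (small_joukowski_root w) < 1"
    by (simp add: small_joukowski_root_def s_def)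
qed

lemma holomorphic_small_joukowski_root [holomorphic_intros]:
  assumes "f holomorphic_on S" "\<And>z. z \<in> S \<Longrightarrow> f z \<notin> complex_of_real ` {-1..1}"
  shows "(\<lambda>z. small_joukowski_root (f z)) holomorphic_on S"
proof -
  have "f z \<noteq> 0" if "z \<in> S" for z using assms(2)[OF that] by force
  then show ?thesis
    unfolding small_joukowski_root_def
    by (intro holomorphic_intros holomorphic_on_csqrt' one_minus_inverse_square_notin_nonpos_Reals assms) auto
qed

text \<open>The branch of the Joukowski root that continues analytically through the cut \<open>[-1, 1]\<close>.\<close>
definition crossing_joukowski_root :: "complex \<Rightarrow> complex" where
  "crossing_joukowski_root w = w - \<i> * csqrt (1 - w\<^sup>2)"

lemma crossing_joukowski_root_eq:
  "(crossing_joukowski_root w)\<^sup>2 + 1 = 2 * w * crossing_joukowski_root w"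
proof -
  define s where "s = csqrt (1 - w\<^sup>2)"
  have "(w - \<i> * s)\<^sup>2 + 1 - 2 * w * (w - \<i> * s) = 1 - w\<^sup>2 - s\<^sup>2"
    by (simp add: algebra_simps power2_eq_square)
  then show ?thesis by (simp add: crossing_joukowski_root_def s_def)
qed

lemma one_minus_square_notin_nonpos_Reals:
  fixes w :: complex
  assumes "norm w < 1"
  shows "1 - w\<^sup>2 \<notin> \<real>\<^sub>\<le>\<^sub>0"
proof -
  have "Re (w\<^sup>2) \<le> (norm w)\<^sup>2" using complex_Re_le_cmod[of "w\<^sup>2"] by (simp add: norm_power)
  also have "\<dots> < 1" using assms by (simp add: power_less_one_iff abs_square_less_1)
  finally show ?thesis by (simp add: complex_nonpos_Reals_iff)
qed

text \<open>The roots \<open>w - \<i> * s\<close> and \<open>w + \<i> * s\<close> have product 1, so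
  it suffices to compare their moduli. The difference of the squared moduli has the sign of
  \<open>Im w\<close>.\<close>

lemma
  assumes "norm w < 1"
  shows norm_crossing_joukowski_root_less: "Im w > 0 \<Longrightarrow> norm (crossing_joukowski_root w) < 1"
    and norm_crossing_joukowski_root_greater: "Im w < 0 \<Longrightarrow> norm (crossing_joukowski_root w) > 1"
proof -
  define s where "s = csqrt (1 - w\<^sup>2)"
  have s2: "s\<^sup>2 = 1 - w\<^sup>2" by (simp add: s_def)
  have "Re s > 0"
    unfolding s_def by (intro Re_csqrt_pos one_minus_square_notin_nonpos_Reals assms)
  \<comment> \<open>Comparing imaginary parts eliminates \<open>Im s\<close>; the difference of
    squares then becomes \<open>4 * (Im w * k)\<close> with \<open>k > 0\<close>.\<close>
  have "Im (s\<^sup>2) = Im (1 - w\<^sup>2)" by (simp only: s2)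
  then have "Im s * Re s = - Re w * Im w" by (simp add: power2_eq_square)
  then have Im_s: "Im s = - Re w * Im w / Re s" using \<open>Re s > 0\<close> by (simp add: field_simps)
  define k where "k = Re s + (Re w)\<^sup>2 / Re s"
  have "k > 0" using \<open>Re s > 0\<close> by (simp add: k_def add_pos_nonneg)
  have "(norm (w + \<i> * s))\<^sup>2 - (norm (w - \<i> * s))\<^sup>2 = 4 * (Im w * Re s - Re w * Im s)"
    unfolding cmod_power2 by (simp add: power2_eq_square algebra_simps)
  also have "\<dots> = 4 * (Im w * k)"
    unfolding Im_s k_def by (simp add: algebra_simps power2_eq_square)
  finally have diff: "(norm (w + \<i> * s))\<^sup>2 - (norm (w - \<i> * s))\<^sup>2 = 4 * (Im w * k)" .
  have "(w + \<i> * s) * (w - \<i> * s) = w\<^sup>2 + s\<^sup>2"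
    by (simp add: algebra_simps power2_eq_square)
  then have prod: "norm (w + \<i> * s) * norm (w - \<i> * s) = 1"
    unfolding s2 by (metis add.commute diff_add_cancel norm_mult norm_one)
  have *: "crossing_joukowski_root w = w - \<i> * s"
    by (simp add: crossing_joukowski_root_def s_def)
  show "norm (crossing_joukowski_root w) < 1" if "Im w > 0"
  proof -
    have "0 < Im w * k" using that \<open>k > 0\<close> by simp
    then have "(norm (w - \<i> * s))\<^sup>2 < (norm (w + \<i> * s))\<^sup>2" using diff by linarith
    then have "norm (w - \<i> * s) < norm (w + \<i> * s)" by (rule power2_less_imp_less) simp
    then show ?thesis unfolding * using prod
      by (metis linorder_not_less mult_le_cancel_right1 norm_ge_zero not_one_less_zero order_less_le_trans linorder_not_le mult.commute)
  qed
  show "norm (crossing_joukowski_root w) > 1" if "Im w < 0"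
  proof -
    have "0 > Im w * k" using that \<open>k > 0\<close> by (simp add: mult_neg_pos)
    then have "(norm (w + \<i> * s))\<^sup>2 < (norm (w - \<i> * s))\<^sup>2" using diff by linarith
    then have "norm (w + \<i> * s) < norm (w - \<i> * s)" by (rule power2_less_imp_less) simp
    then show ?thesis unfolding * using prod
      by (metis linorder_not_less mult_le_cancel_right1 norm_ge_zero not_one_less_zero order_less_le_trans linorder_not_le mult.commute)
  qed
qed

lemma holomorphic_crossing_joukowski_root [holomorphic_intros]:
  assumes "f holomorphic_on S" "\<And>z. z \<in> S \<Longrightarrow> norm (f z) < 1"
  shows "(\<lambda>z. crossing_joukowski_root (f z)) holomorphic_on S"
  unfolding crossing_joukowski_root_def
  by (intro holomorphic_intros holomorphic_on_csqrt' one_minus_square_notin_nonpos_Reals assms)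

section \<open>The resolvent on the physical sheet\<close>

context perturbed_jacobi
begin

fun dirichlet :: "complex \<Rightarrow> nat \<Rightarrow> complex" where
  "dirichlet z 0 = 0"
| "dirichlet z (Suc 0) = 1"
| "dirichlet z (Suc (Suc n)) = ((z - d (Suc n)) * dirichlet z (Suc n) - c n * dirichlet z n) / c (Suc n)"

lemma solves_dirichlet: "solves z (dirichlet z)"
proof -
  have "c (Suc n) * dirichlet z (Suc (Suc n)) = (z - d (Suc n)) * dirichlet z (Suc n) - c n * dirichlet z n" for n
    by simp
  then show ?thesis
    unfolding solves_def by (simp add: algebra_simps del: dirichlet.simps)
qed

lemma holomorphic_dirichlet: "(\<lambda>z. dirichlet z n) holomorphic_on S"
proof (induction n rule: less_induct)
  case (less n)
  consider "n = 0" | "n = Suc 0" | m where "n = Suc (Suc m)"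
    by (metis not0_implies_Suc)
  then show ?case
    by cases (use less in \<open>auto intro!: holomorphic_intros\<close>)
qed

text \<open>Not yet divided by the Wronskian: this numerator is polynomial in \<open>z\<close> and
  \<open>\<theta>\<close>, so it stays finite at zeros of the Jost function.\<close>

definition green :: "complex \<Rightarrow> complex \<Rightarrow> nat \<Rightarrow> nat \<Rightarrow> complex" where
  "green z \<theta> m n = dirichlet z (min m n) * jost z \<theta> (max m n)"

text \<open>Off the site \<open>m\<close> one factor is constant and the other solves the
  recurrence. At \<open>m\<close> the switch from one factor to the other leaves their Wronskian,
  evaluated at site 0.\<close>

lemma green_equation:
  assumes "floquet z \<theta>" "m \<ge> 1"
  shows "c n * green z \<theta> m n + c (Suc n) * green z \<theta> m (Suc (Suc n)) + d (Suc n) * green z \<theta> m (Suc n)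
           - z * green z \<theta> m (Suc n) = (if Suc n = m then - c 0 * jost z \<theta> 0 else 0)"
proof -
  note sj = solves_jost[OF assms(1), unfolded solves_def, rule_format, of n]
  note sd = solves_dirichlet[of z, unfolded solves_def, rule_format, of n]
  consider "Suc n < m" | "Suc n = m" | "m \<le> n" by linarith
  then show ?thesis
  proof cases
    case 1
    then have "c n * green z \<theta> m n + c (Suc n) * green z \<theta> m (Suc (Suc n)) + d (Suc n) * green z \<theta> m (Suc n)
       = (c n * dirichlet z n + c (Suc n) * dirichlet z (Suc (Suc n)) + d (Suc n) * dirichlet z (Suc n)) * jost z \<theta> m"
      unfolding green_def by (simp add: min_absorb2 max_absorb1 algebra_simps del: dirichlet.simps)
    then show ?thesis using 1 unfolding sd
      by (simp add: green_def min_absorb2 max_absorb1 del: dirichlet.simps)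
  next
    case 3
    then have "c n * green z \<theta> m n + c (Suc n) * green z \<theta> m (Suc (Suc n)) + d (Suc n) * green z \<theta> m (Suc n)
       = dirichlet z m * (c n * jost z \<theta> n + c (Suc n) * jost z \<theta> (Suc (Suc n)) + d (Suc n) * jost z \<theta> (Suc n))"
      unfolding green_def by (simp add: min_absorb1 max_absorb2 algebra_simps del: dirichlet.simps)
    then show ?thesis using 3 unfolding sj
      by (simp add: green_def min_absorb1 max_absorb2 del: dirichlet.simps)
  next
    case 2
    then have "c n * green z \<theta> m n + c (Suc n) * green z \<theta> m (Suc (Suc n)) + d (Suc n) * green z \<theta> m (Suc n)
         - z * green z \<theta> m (Suc n)
       = c n * (dirichlet z n * jost z \<theta> (Suc n)) +
         dirichlet z (Suc n) * ((c n * jost z \<theta> n + c (Suc n) * jost z \<theta> (Suc (Suc n)) + d (Suc n) * jost z \<theta> (Suc n))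
            - c n * jost z \<theta> n - z * jost z \<theta> (Suc n))"
      unfolding green_def by (simp add: min_absorb1 max_absorb2 min_absorb2 max_absorb1 algebra_simps del: dirichlet.simps)
    also have "\<dots> = c n * (dirichlet z n * jost z \<theta> (Suc n) - dirichlet z (Suc n) * jost z \<theta> n)"
      unfolding sj by (simp add: algebra_simps del: dirichlet.simps)
    also have "\<dots> = - c 0 * jost z \<theta> 0"
      unfolding wronskian_constant[OF solves_dirichlet solves_jost[OF assms(1)]] by simp
    finally show ?thesis using 2 by simp
  qed
qed

lemma floquet_decaying_solution_zero:
  assumes "floquet z \<theta>" "norm \<theta> \<le> 1" "jost z \<theta> 0 \<noteq> 0"
    and "solves z y" "y 0 = 0" "y \<longlonglongrightarrow> 0"
  shows "y = (\<lambda>_. 0)"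
proof (rule decaying_solution_zero[OF assms(4-6) solves_jost[OF assms(1)] _ assms(3)])
  show "bounded (range (jost z \<theta>))"
    using jost_tail assms(2) by (rule geometric_tail_bounded)
qed

text \<open>Numerator of the resolvent matrix element. With \<open>z\<close> and
  \<open>\<theta>\<close> kept as separate arguments, one formula serves both sheets: passing to the
  other sheet inverts \<open>\<theta>\<close>.\<close>

definition green_form :: "(nat \<Rightarrow> complex) \<Rightarrow> (nat \<Rightarrow> complex) \<Rightarrow> complex \<Rightarrow> complex \<Rightarrow> complex" where
  "green_form f g z \<theta> = (\<Sum>n\<in>{n. g n \<noteq> 0}. (\<Sum>m\<in>{m. f m \<noteq> 0}. green z \<theta> m n * f m) * cnj (g n))"

text \<open>The Green function yields an l2 solution. Two such solutions differ by a decaying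
  homogeneous one, which is 0, so the definite description denotes this solution and the default
  value 0 is not taken.\<close>

lemma resolvent_form_eq:
  assumes f: "fin_supp f" and \<theta>: "floquet z \<theta>" "norm \<theta> < 1" and nz: "jost z \<theta> 0 \<noteq> 0"
  shows "resolvent_form a v q f g z = green_form f g z \<theta> / (- c 0 * jost z \<theta> 0)"
proof -
  define S where "S = {m. f m \<noteq> 0}"
  have S: "finite S" "0 \<notin> S" using f by (auto simp: fin_supp_def S_def)
  define D where "D = - c 0 * jost z \<theta> 0"
  have D: "D \<noteq> 0" using nz by (simp add: D_def)
  define y where "y n = (\<Sum>m\<in>S. green z \<theta> m n * f m) / D" for n
  let ?P = "\<lambda>y. l2_vec y \<and> (\<forall>n\<ge>1. jac_apply a v q y n - z * y n = f n)"
  have y0: "y 0 = 0" by (simp add: y_def green_def)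
  \<comment> \<open>Beyond \<open>M\<close> all sources and all perturbed sites have been passed, so
    two steps multiply \<open>y\<close> by \<open>\<theta>\<close>.\<close>
  obtain M where M: "\<And>m. m \<in> S \<Longrightarrow> m \<le> M" "p \<le> M"
    by (metis S(1) finite_nat_set_iff_bounded_le le_trans max.cobounded1 max.cobounded2)
  have tail: "y (Suc (Suc n)) = \<theta> * y n" if "n \<ge> M" for n
  proof -
    have "green z \<theta> m (Suc (Suc n)) = \<theta> * green z \<theta> m n" if "m \<in> S" for m
      using M(1)[OF that] M(2) \<open>n \<ge> M\<close> jost_tail[of n]
      by (simp add: green_def min_absorb1 max_absorb2)
    then show ?thesis by (simp add: y_def sum_distrib_left mult.assoc)
  qed
  have "l2_vec y"
    unfolding l2_vec_def
    using geometric_tail_summable[where y = y, OF tail floquet_nonzero[OF \<theta>(1)] \<theta>(2)] y0 by blast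
  moreover have "jac_apply a v q y n - z * y n = f n" if n: "n \<ge> 1" for n
  proof -
    obtain k where k: "n = Suc k" using n by (cases n) auto
    have "jac_apply a v q y n - z * y n = (\<Sum>m\<in>S. (c k * green z \<theta> m k + c (Suc k) * green z \<theta> m (Suc (Suc k))
         + d (Suc k) * green z \<theta> m (Suc k) - z * green z \<theta> m (Suc k)) * f m) / D"
      unfolding k jac_apply_Suc[where y = y, OF y0] y_def
      by (simp add: sum_distrib_left sum_subtractf sum.distrib algebra_simps add_divide_distrib diff_divide_distrib del: of_real_add)
    also have "\<dots> = (\<Sum>m\<in>S. (if Suc k = m then D else 0) * f m) / D"
    proof -
      have "m \<ge> 1" if "m \<in> S" for m using that S by (cases m) auto
      then show ?thesis unfolding D_def by (simp add: green_equation[OF \<theta>(1)] del: of_real_add cong: sum.cong)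
    qed
    also have "\<dots> = f n"
      using S(1) D by (simp add: k S_def if_distrib[where f = "\<lambda>x. x * _"] cong: if_cong)
    finally show ?thesis .
  qed
  ultimately have Py: "?P y" by blast
  have uniq: "x = y" if "?P x" for x
  proof -
    define u where "u n = x n - y n" for n
    have x0: "x 0 = 0" using that by (simp add: l2_vec_def)
    have u0: "u 0 = 0" using x0 y0 by (simp add: u_def)
    have "jac_apply a v q u n = z * u n" if "n \<ge> 1" for n
    proof -
      have "jac_apply a v q u n = jac_apply a v q x n - jac_apply a v q y n"
        by (simp add: jac_apply_def u_def algebra_simps)
      then show ?thesis using \<open>?P x\<close> Py that by (simp add: u_def algebra_simps)
    qed
    then have "solves z u" using jac_apply_eq_iff_solves[where y = u, OF u0] by blast
    moreover have "u \<longlonglongrightarrow> 0"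
      using tendsto_diff[OF l2_vec_tendsto_0[of x] l2_vec_tendsto_0[of y]] that Py
      by (simp add: u_def[abs_def])
    ultimately have "u = (\<lambda>_. 0)"
      using floquet_decaying_solution_zero[where y = u, OF \<theta>(1) _ nz _ u0] \<theta>(2) by simp
    then show ?thesis by (metis eq_iff_diff_eq_0 ext u_def)
  qed
  have ex1: "\<exists>!y. ?P y" using Py uniq by blast
  have the: "(THE y. ?P y) = y" using Py uniq by (rule the_equality)
  have "resolvent_form a v q f g z = (\<Sum>n\<in>{n. g n \<noteq> 0}. y n * cnj (g n))"
    unfolding resolvent_form_def if_P[OF ex1] the Let_def ..
  also have "\<dots> = green_form f g z \<theta> / D"
    by (simp add: y_def green_form_def S_def sum_divide_distrib[of _ "{n. g n \<noteq> 0}"])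
  finally show ?thesis by (simp add: D_def)
qed

lemma holomorphic_green_form:
  assumes "\<theta> holomorphic_on S"
  shows "(\<lambda>z. green_form f g z (\<theta> z)) holomorphic_on S"
  unfolding green_form_def green_def
  by (intro holomorphic_intros holomorphic_dirichlet holomorphic_jost assms)

text \<open>Letting \<open>z\<close> and \<open>\<theta>\<close> range independently over compact
  discs gives a bound that does not depend on how the multiplier behaves near a band edge.\<close>

lemma norm_green_form_bounded:
  "\<exists>B. \<forall>z \<theta>. norm z \<le> R \<longrightarrow> norm \<theta> \<le> K \<longrightarrow> norm (green_form f g z \<theta>) \<le> B"
proof -
  have "continuous_on S (\<lambda>x. dirichlet (fst x) n)" for n and S :: "(complex \<times> complex) set"
    using continuous_on_compose2[OF holomorphic_on_imp_continuous_on[OF holomorphic_dirichlet[of n UNIV]],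
        of S fst] by (simp add: continuous_on_fst continuous_on_id)
  then have "continuous_on (cball 0 R \<times> cball 0 K) (\<lambda>x. green_form f g (fst x) (snd x))"
    unfolding green_form_def green_def by (intro continuous_intros continuous_on_jost)
  then have "bounded ((\<lambda>x. green_form f g (fst x) (snd x)) ` (cball 0 R \<times> cball 0 K))"
    by (intro compact_imp_bounded compact_continuous_image compact_Times compact_cball)
  then show ?thesis by (force simp: bounded_iff)
qed

section \<open>The Floquet discriminant and the eigenvalues\<close>

definition half_discriminant :: "complex \<Rightarrow> complex" where
  "half_discriminant z = (z\<^sup>2 - (complex_of_real v)\<^sup>2 - 1 - (complex_of_real a)\<^sup>2) / (2 * complex_of_real a)"

text \<open>The sum of the two multipliers is \<open>2 * half_discriminant z\<close>, the trace of
  the transfer matrix over one period. In this variable the Floquet equation is the Joukowski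
  equation.\<close>

lemma floquet_iff: "floquet z \<theta> \<longleftrightarrow> \<theta>\<^sup>2 + 1 = 2 * half_discriminant z * \<theta>"
proof -
  have "(1 + complex_of_real a * \<theta>) * (complex_of_real a + \<theta>) - \<theta> * (z\<^sup>2 - (complex_of_real v)\<^sup>2)
    = complex_of_real a * (\<theta>\<^sup>2 + 1 - 2 * half_discriminant z * \<theta>)"
    using a_pos by (simp add: half_discriminant_def field_simps power2_eq_square)
  then show ?thesis using a_pos unfolding floquet_def
    by (metis mult_eq_0_iff of_real_eq_0_iff order_less_irrefl eq_iff_diff_eq_0)
qed

lemma holomorphic_half_discriminant [holomorphic_intros]: "half_discriminant holomorphic_on S"
  unfolding half_discriminant_def using a_pos by (intro holomorphic_intros) auto

lemma floquet_unique:
  assumes "floquet z \<theta>" "floquet z \<theta>'"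
  shows "\<theta>' = \<theta> \<or> \<theta>' = inverse \<theta>"
proof -
  have nz: "\<theta> \<noteq> 0" "\<theta>' \<noteq> 0" using assms floquet_nonzero by auto
  have "(\<theta>' - \<theta>) * (\<theta> * \<theta>' - 1) = \<theta> * (\<theta>'\<^sup>2 + 1) - \<theta>' * (\<theta>\<^sup>2 + 1)"
    by (simp add: algebra_simps power2_eq_square)
  also have "\<dots> = 0"
    using assms unfolding floquet_iff by (simp add: mult_ac)
  finally have "\<theta>' = \<theta> \<or> \<theta>' * \<theta> = 1" by (auto simp: mult.commute)
  then show ?thesis using nz by (auto simp: divide_simps inverse_eq_divide)
qed

lemma ex_floquet_le_1: "\<exists>\<theta>. floquet z \<theta> \<and> norm \<theta> \<le> 1"
proof -
  have *: "floquet z (crossing_joukowski_root (half_discriminant z))"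
    unfolding floquet_iff by (rule crossing_joukowski_root_eq)
  show ?thesis
  proof (cases "norm (crossing_joukowski_root (half_discriminant z)) \<le> 1")
    case False
    then show ?thesis using floquet_inverse[OF *]
      by (intro exI[of _ "inverse (crossing_joukowski_root (half_discriminant z))"])
        (simp add: norm_inverse inverse_le_1_iff)
  qed (use * in blast)
qed

text \<open>An eigenvector is a decaying solution vanishing at 0, which a nonzero Jost function
  forbids. Eigenvalues are not assumed to lie off the bands, hence the multiplier of modulus at most
  1.\<close>

lemma eigenvalue_imp_jost_zero:
  assumes "eigenvalue_J a v q \<mu>"
  shows "\<exists>\<theta>. floquet \<mu> \<theta> \<and> jost \<mu> \<theta> 0 = 0"
proof -
  obtain \<theta> where \<theta>: "floquet \<mu> \<theta>" "norm \<theta> \<le> 1" using ex_floquet_le_1 by blast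
  obtain y where y: "l2_vec y" "y \<noteq> (\<lambda>_. 0)" "\<forall>n\<ge>1. jac_apply a v q y n = \<mu> * y n"
    using assms by (auto simp: eigenvalue_J_def)
  have y0: "y 0 = 0" using y by (simp add: l2_vec_def)
  have "solves \<mu> y" using y(3) jac_apply_eq_iff_solves[where y = y, OF y0] by blast
  then show ?thesis
    using floquet_decaying_solution_zero[OF \<theta> _ _ y0 l2_vec_tendsto_0[OF y(1)]] \<theta>(1) y(2) by blast
qed

text \<open>A value \<open>x\<close> in \<open>[-1, 1]\<close> means
  \<open>z\<^sup>2 = v\<^sup>2 + 1 + a\<^sup>2 + 2 * a * x\<close>, which lies between the squares
  of the inner and outer band edges.\<close>

lemma half_discriminant_notin_cut:
  assumes "z \<notin> sigma_ac a v"
  shows "half_discriminant z \<notin> complex_of_real ` {-1..1}"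
proof
  assume "half_discriminant z \<in> complex_of_real ` {-1..1}"
  then obtain x where x: "half_discriminant z = complex_of_real x" "-1 \<le> x" "x \<le> 1" by auto
  define y where "y = v\<^sup>2 + 1 + a\<^sup>2 + 2 * a * x"
  have z2: "z\<^sup>2 = complex_of_real y"
    using x a_pos by (simp add: half_discriminant_def y_def field_simps)
  have ax: "a * x \<le> a" "- a \<le> a * x"
    using x a_pos mult_left_mono[of x 1 a] mult_left_mono[of "-1" x a] by auto
  have lo: "v\<^sup>2 + (a - 1)\<^sup>2 \<le> y" and hi: "y \<le> v\<^sup>2 + (a + 1)\<^sup>2"
    using ax by (simp_all add: y_def power2_eq_square algebra_simps)
  have "y \<ge> 0" using lo by (rule order_trans[rotated]) simp
  define r where "r = sqrt y"
  have "z\<^sup>2 = (complex_of_real r)\<^sup>2"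
    using z2 \<open>y \<ge> 0\<close> by (simp add: r_def flip: of_real_power)
  then have "z = complex_of_real r \<or> z = complex_of_real (- r)"
    by (simp add: power2_eq_iff)
  moreover have "lam1p a v \<le> r" "r \<le> lam0m a v" "- r \<le> lam1m a v" "lam0p a v \<le> - r"
    using lo hi by (auto simp: lam1p_def lam0m_def lam1m_def lam0p_def r_def)
  ultimately show False using assms unfolding sigma_ac_def by fastforce
qed

section \<open>The multiplier on the physical sheet and virtual states\<close>

definition physical_multiplier :: "complex \<Rightarrow> complex" where
  "physical_multiplier z = small_joukowski_root (half_discriminant z)"

lemma
  assumes "z \<notin> sigma_ac a v"
  shows floquet_physical: "floquet z (physical_multiplier z)"
    and norm_physical: "norm (physical_multiplier z) < 1"
  using half_discriminant_notin_cut[OF assms] small_joukowski_root_eq norm_small_joukowski_root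
  by (auto simp: floquet_iff physical_multiplier_def)

lemma holomorphic_physical: "physical_multiplier holomorphic_on - sigma_ac a v"
  unfolding physical_multiplier_def[abs_def]
  by (intro holomorphic_intros) (use half_discriminant_notin_cut in auto)

text \<open>Near \<open>\<mu>\<close> the numerator is bounded by compactness and the denominator
  stays away from 0, so every matrix element is bounded off the bands.\<close>

lemma not_virtual_state:
  assumes "r > 0" "e > 0"
    and lower: "\<And>z \<theta>. z \<in> ball \<mu> r \<Longrightarrow> floquet z \<theta> \<Longrightarrow> e \<le> norm (jost z \<theta> 0)"
  shows "\<not> virtual_state a v q \<mu>"
proof
  assume "virtual_state a v q \<mu>"
  then obtain f g where f: "fin_supp f"
    and unb: "\<not> (\<exists>r>0. \<exists>B. \<forall>z\<in>ball \<mu> r - sigma_ac a v. \<not> eigenvalue_J a v q z \<longrightarrow>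
                 cmod (resolvent_form a v q f g z) \<le> B)"
    by (auto simp: virtual_state_def)
  define R where "R = norm \<mu> + r"
  obtain B where B: "\<And>z \<theta>. norm z \<le> R \<Longrightarrow> norm \<theta> \<le> floquet_bound R \<Longrightarrow> norm (green_form f g z \<theta>) \<le> B"
    using norm_green_form_bounded by blast
  have "norm (resolvent_form a v q f g z) \<le> B / (a * e)" if z: "z \<in> ball \<mu> r - sigma_ac a v" for z
  proof -
    note fl = floquet_physical[of z] norm_physical[of z]
    have jo: "e \<le> norm (jost z (physical_multiplier z) 0)" using z fl lower by auto
    have "norm z \<le> R"
      using z norm_triangle_ineq[of \<mu> "z - \<mu>"] by (auto simp: R_def dist_norm norm_minus_commute)
    then have num: "norm (green_form f g z (physical_multiplier z)) \<le> B"
      using z by (intro B norm_floquet_le[OF fl(1)]) auto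
    have "resolvent_form a v q f g z = green_form f g z (physical_multiplier z) / (- c 0 * jost z (physical_multiplier z) 0)"
      using z jo \<open>e > 0\<close> by (intro resolvent_form_eq f fl) auto
    then have "norm (resolvent_form a v q f g z)
        = norm (green_form f g z (physical_multiplier z)) / (a * norm (jost z (physical_multiplier z) 0))"
      using a_pos by (simp add: norm_divide norm_mult acoef_def)
    also have "\<dots> \<le> B / (a * e)"
      using jo num a_pos \<open>e > 0\<close> order_trans[OF norm_ge_zero num] by (intro frac_le mult_left_mono) auto
    finally show ?thesis .
  qed
  then show False using unb \<open>r > 0\<close> by blast
qed

end

section \<open>Resonances\<close>

lemma connected_Compl_sigma_ac: "connected (- sigma_ac a v)"
proof -
  have real: "Im z = 0" if "z \<in> sigma_ac a v" for z
    using that by (auto simp: sigma_ac_def)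
  \<comment> \<open>\<open>U 1\<close> and \<open>U (-1)\<close> are the closed upper and lower
    half-planes without the bands. Each lies between an open half-plane and its closure, and both
    contain the real points to the right of the bands.\<close>
  define U where "U = (\<lambda>s::real. - sigma_ac a v \<inter> {z. 0 \<le> s * Im z})"
  have "connected (U s)" if "s \<noteq> 0" for s
  proof (rule connected_intermediate_closure)
    have hs: "{z. 0 < s * Im z} = {z. inner (complex_of_real s * \<i>) z > 0}"
      by (simp add: inner_complex_def)
    show "connected {z. 0 < s * Im z}"
      unfolding hs by (intro convex_connected convex_halfspace_gt)
    show "{z. 0 < s * Im z} \<subseteq> U s" using real by (fastforce simp: U_def)
    have "complex_of_real s * \<i> \<noteq> 0" using that by simp
    then have "closure {z. 0 < s * Im z} = {z. 0 \<le> s * Im z}"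
      unfolding hs by (subst closure_halfspace_gt) (auto simp: inner_complex_def)
    then show "U s \<subseteq> closure {z. 0 < s * Im z}" by (auto simp: U_def)
  qed
  then have "connected (U 1 \<union> U (-1))"
  proof (intro connected_Un)
    have "complex_of_real (\<bar>lam0m a v\<bar> + \<bar>lam1m a v\<bar> + 1) \<in> U 1 \<inter> U (-1)"
      by (auto simp: U_def sigma_ac_def simp del: of_real_add)
    then show "U 1 \<inter> U (-1) \<noteq> {}" by blast
  qed auto
  moreover have "U 1 \<union> U (-1) = - sigma_ac a v" by (auto simp: U_def)
  ultimately show ?thesis by simp
qed

lemma closed_sigma_ac: "closed (sigma_ac a v)"
  unfolding sigma_ac_def
  by (intro compact_imp_closed compact_continuous_image continuous_intros compact_Un compact_Icc)

lemma sparse_inI: "(\<And>z. z \<in> S \<Longrightarrow> \<not> z islimpt P) \<Longrightarrow> open S \<Longrightarrow> P sparse_in S"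
  unfolding sparse_in_def by blast

text \<open>Deleting a sparse set keeps an open connected set connected and open, so the ordinary
  identity theorem applies. The seed \<open>A \<inter> S - P\<close> is nonempty because points of
  an open set are limit points of it.\<close>

lemma holomorphic_eq_off_sparse:
  fixes f g :: "complex \<Rightarrow> complex"
  assumes "open S" "connected S" "P sparse_in S" "f holomorphic_on S - P" "g holomorphic_on S - P"
    and "open A" "A \<inter> S \<noteq> {}" "\<And>z. z \<in> A \<inter> S - P \<Longrightarrow> f z = g z" "z \<in> S - P"
  shows "f z = g z"
proof (rule analytic_continuation_open[where f = f and g = g and s = "A \<inter> S - P" and s' = "S - P"])
  have "P sparse_in A \<inter> S" using assms(3) by (rule sparse_in_subset) auto
  then show "open (A \<inter> S - P)" using assms by (intro open_diff_sparse_pts) auto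
  show "A \<inter> S - P \<noteq> {}"
  proof
    assume "A \<inter> S - P = {}"
    then have "A \<inter> S \<subseteq> P" by blast
    moreover obtain z where z: "z \<in> A \<inter> S" using assms(7) by blast
    have "z islimpt A \<inter> S" using z assms by (intro interior_limit_point) (simp add: interior_open open_Int)
    ultimately have "z islimpt P" by (rule islimpt_subset[rotated])
    then show False using assms(3) z by (auto simp: sparse_in_def)
  qed
  show "open (S - P)" "connected (S - P)"
    using assms by (auto intro: open_diff_sparse_pts sparse_imp_connected)
qed (use assms in auto)

context perturbed_jacobi
begin

section \<open>An interior band point and the multiplier continued across it\<close>

definition band_point :: complex where
  "band_point = complex_of_real (sqrt (v\<^sup>2 + 1 + a\<^sup>2))"

text \<open>The point is the positive zero of \<open>half_discriminant\<close>. It is interior to a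
  band because \<open>1 + a\<^sup>2\<close> lies strictly between \<open>(a - 1)\<^sup>2\<close> and
  \<open>(a + 1)\<^sup>2\<close>.\<close>

lemma band_point_in: "band_point \<in> sigma_ac a v - band_edges a v"
proof -
  define x y z where "x = sqrt (v\<^sup>2 + (a - 1)\<^sup>2)" and "y = sqrt (v\<^sup>2 + 1 + a\<^sup>2)"
    and "z = sqrt (v\<^sup>2 + (a + 1)\<^sup>2)"
  note xyz = x_def [symmetric] y_def [symmetric] z_def [symmetric]
  have "0 \<le> x" by (simp add: x_def)
  moreover have "x < y" "y < z"
    using a_pos by (auto simp: x_def y_def z_def power2_eq_square algebra_simps)
  ultimately show ?thesis
    unfolding band_point_def sigma_ac_def band_edges_def lam0p_def lam0m_def lam1p_def lam1m_def xyz
    by (auto simp: image_iff simp flip: of_real_minus)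
qed

text \<open>Separates the band point from both \<open>v\<close> and \<open>- v\<close>, so that the
  lower bound on the Jost function is available around it.\<close>

lemma Re_band_point: "Re band_point > \<bar>v\<bar>"
proof -
  have "sqrt (v\<^sup>2) < sqrt (v\<^sup>2 + 1 + a\<^sup>2)"
    by (intro real_sqrt_less_mono) (simp add: add_pos_nonneg)
  then show ?thesis by (simp add: band_point_def)
qed

lemma norm_band_point: "norm band_point = Re band_point"
  by (simp add: band_point_def)

lemma half_discriminant_band_point: "half_discriminant band_point = 0"
proof -
  have "band_point\<^sup>2 = complex_of_real (v\<^sup>2 + 1 + a\<^sup>2)"
    unfolding band_point_def of_real_power[symmetric] by (simp add: add_nonneg_nonneg del: of_real_add)
  then show ?thesis by (simp add: half_discriminant_def)
qed

lemma Im_half_discriminant: "Im (half_discriminant z) = Re z * Im z / a"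
  using a_pos by (simp add: half_discriminant_def Im_divide power2_eq_square field_simps)

definition crossing_multiplier :: "complex \<Rightarrow> complex" where
  "crossing_multiplier z = crossing_joukowski_root (half_discriminant z)"

lemma floquet_crossing: "floquet z (crossing_multiplier z)"
  unfolding floquet_iff crossing_multiplier_def by (rule crossing_joukowski_root_eq)

text \<open>The crossing multiplier is the physical one or its inverse, and its modulus tells which.
  For \<open>Re z > 0\<close> the sign of \<open>Im (half_discriminant z)\<close> is that of
  \<open>Im z\<close>.\<close>

lemma
  assumes "Re z > 0" "norm (half_discriminant z) < 1"
  shows crossing_upper: "Im z > 0 \<Longrightarrow> crossing_multiplier z = physical_multiplier z"
    and crossing_lower: "Im z < 0 \<Longrightarrow> crossing_multiplier z = inverse (physical_multiplier z)"
proof -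
  have off: "z \<notin> sigma_ac a v" if "Im z \<noteq> 0" using that by (auto simp: sigma_ac_def)
  have alt: "crossing_multiplier z = physical_multiplier z \<or> crossing_multiplier z = inverse (physical_multiplier z)"
    if "Im z \<noteq> 0"
    by (rule floquet_unique[OF floquet_physical[OF off[OF that]] floquet_crossing])
  have inv: "norm (inverse (physical_multiplier z)) > 1" if "Im z \<noteq> 0"
    using norm_physical[OF off[OF that]] floquet_nonzero[OF floquet_physical[OF off[OF that]]]
    by (simp add: norm_inverse one_less_inverse_iff)
  show "crossing_multiplier z = physical_multiplier z" if "Im z > 0"
  proof -
    have "norm (crossing_multiplier z) < 1" unfolding crossing_multiplier_def
      using that assms a_pos by (intro norm_crossing_joukowski_root_less) (auto simp: Im_half_discriminant)
    then show ?thesis using alt inv that by force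
  qed
  show "crossing_multiplier z = inverse (physical_multiplier z)" if "Im z < 0"
  proof -
    have "norm (crossing_multiplier z) > 1" unfolding crossing_multiplier_def
      using that assms a_pos
      by (intro norm_crossing_joukowski_root_greater) (auto simp: Im_half_discriminant divide_neg_pos mult_pos_neg)
    then show ?thesis using alt norm_physical[OF off] that by force
  qed
qed

text \<open>Only the gluing at one interior band point is needed: a meromorphic function on a connected set
  is determined by its values on a small half-disc.\<close>
lemma resonance_imp_jost_zero:
  assumes res: "resonance a v q \<mu>" and "\<delta> > 0"
    and nz: "\<And>z \<theta>. z \<in> ball band_point \<delta> \<Longrightarrow> floquet z \<theta> \<Longrightarrow> jost z \<theta> 0 \<noteq> 0"
  shows "\<exists>\<theta>. floquet \<mu> \<theta> \<and> jost \<mu> \<theta> 0 = 0"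
proof (rule ccontr)
  assume contra: "\<not> ?thesis"
  obtain f g G where \<mu>: "\<mu> \<notin> sigma_ac a v" and f: "fin_supp f"
    and G: "second_sheet_cont a v q f g G" and pole: "filterlim G at_infinity (at \<mu>)"
    using res by (auto simp: resonance_def)
  \<comment> \<open>Numerator and denominator of the matrix element. The identities below have the
    form \<open>D * G = N\<close>, which stays meaningful at zeros of \<open>D\<close> elsewhere on
    the sheet.\<close>
  define N where "N \<theta> z = green_form f g z (\<theta> z)" for \<theta> :: "complex \<Rightarrow> complex" and z
  define D where "D \<theta> z = - c 0 * jost z (\<theta> z) 0" for \<theta> :: "complex \<Rightarrow> complex" and z
  have hol: "N \<theta> holomorphic_on S" "D \<theta> holomorphic_on S" if "\<theta> holomorphic_on S" for \<theta> S
    unfolding N_def[abs_def] D_def[abs_def]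
    using that by (auto intro!: holomorphic_intros holomorphic_green_form holomorphic_jost)
  let ?U = "- sigma_ac a v"
  \<comment> \<open>the multiplier on the unphysical sheet\<close>
  define \<theta>' where "\<theta>' z = inverse (physical_multiplier z)" for z
  have \<theta>': "\<theta>' holomorphic_on ?U"
    unfolding \<theta>'_def[abs_def] using floquet_nonzero[OF floquet_physical]
    by (intro holomorphic_intros holomorphic_physical) auto

  obtain P where P: "P sparse_in ?U" "G holomorphic_on ?U - P"
    using G closed_sigma_ac[of a v] unfolding second_sheet_cont_def mero_on_def by (metis sparse_inI open_Compl)
  have "cross_glued band_point (resolvent_form a v q f g) G"
    using G band_point_in unfolding second_sheet_cont_def by blast
  then obtain r h P' where r: "r > 0" and P': "\<forall>z\<in>ball band_point r. \<not> z islimpt P'"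
    and h: "h holomorphic_on ball band_point r - P'"
    and hFG: "\<forall>z\<in>ball band_point r - P'.
      (Im z > 0 \<longrightarrow> h z = resolvent_form a v q f g z) \<and> (Im z < 0 \<longrightarrow> h z = G z)"
    unfolding cross_glued_def by (elim exE conjE)
  have "\<forall>\<^sub>F z in nhds band_point. norm (half_discriminant z) < 1"
  proof -
    have "isCont half_discriminant band_point"
      using holomorphic_half_discriminant[of UNIV] holomorphic_on_imp_continuous_on continuous_on_eq_continuous_at by blast
    then have "(half_discriminant \<longlongrightarrow> 0) (nhds band_point)"
      by (simp add: isCont_def tendsto_nhds_iff half_discriminant_band_point)
    from tendstoD[OF this, of 1] show ?thesis by simp
  qed
  then obtain r' where r': "r' > 0" "\<And>z. z \<in> ball band_point r' \<Longrightarrow> norm (half_discriminant z) < 1"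
    unfolding eventually_nhds_metric by (auto simp: dist_commute)
  \<comment> \<open>Small enough for the gluing, for the crossing root to be analytic, for the Jost
    function not to vanish, and for \<open>Re z > 0\<close>.\<close>
  define \<rho> where "\<rho> = Min {r, r', \<delta>, Re band_point}"
  have Re0: "Re band_point > 0" using Re_band_point by linarith
  have \<rho>: "\<rho> > 0" using r r' \<open>\<delta> > 0\<close> Re0 by (simp add: \<rho>_def)
  define Bl where "Bl = ball band_point \<rho>"
  have Bl: "Bl \<subseteq> ball band_point r" "Bl \<subseteq> ball band_point r'" "Bl \<subseteq> ball band_point \<delta>"
    unfolding Bl_def by (auto intro!: subset_ball simp: \<rho>_def)
  have Re_pos: "Re z > 0" if "z \<in> Bl" for z
  proof -
    have "\<bar>Re (band_point - z)\<bar> < Re band_point"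
      using that abs_Re_le_cmod[of "band_point - z"] by (simp add: Bl_def dist_norm \<rho>_def)
    then show ?thesis by simp
  qed
  have cross: "crossing_multiplier holomorphic_on Bl"
    unfolding crossing_multiplier_def[abs_def] using Bl r' by (intro holomorphic_intros) auto
  have sparse': "P' sparse_in Bl"
    using P' Bl by (intro sparse_inI) (auto simp: Bl_def)

  \<comment> \<open>In the upper half of \<open>Bl\<close>, \<open>h\<close> is the resolvent form
    and the crossing multiplier is the physical one. The identity theorem carries the formula across
    the band.\<close>
  have glue: "D crossing_multiplier z * h z = N crossing_multiplier z" if z: "z \<in> Bl - P'" for z
  proof (rule holomorphic_eq_off_sparse[OF _ _ sparse' _ _ _ _ _ z])
    show "open Bl" "connected Bl" by (auto simp: Bl_def)
    show "(\<lambda>z. D crossing_multiplier z * h z) holomorphic_on Bl - P'"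
      using Bl by (intro holomorphic_on_mult hol holomorphic_on_subset[OF h] holomorphic_on_subset[OF cross]) auto
    show "N crossing_multiplier holomorphic_on Bl - P'"
      by (intro hol holomorphic_on_subset[OF cross]) auto
    show "open {z. Im z > 0}" by (simp add: open_halfspace_Im_gt)
    have "band_point + complex_of_real (\<rho> / 2) * \<i> \<in> {z. Im z > 0} \<inter> Bl"
      using \<rho> by (simp add: Bl_def dist_norm norm_mult band_point_def)
    then show "{z. Im z > 0} \<inter> Bl \<noteq> {}" by blast
    fix z assume "z \<in> {z. Im z > 0} \<inter> Bl - P'"
    then have z: "Im z > 0" "z \<in> Bl" "z \<notin> P'" by auto
    have off: "z \<notin> sigma_ac a v" using z by (auto simp: sigma_ac_def)
    have nz: "jost z (physical_multiplier z) 0 \<noteq> 0"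
      using z Bl floquet_physical[OF off] by (intro nz) auto
    have eq: "crossing_multiplier z = physical_multiplier z"
      using z Re_pos r' Bl by (intro crossing_upper) auto
    have "h z = green_form f g z (physical_multiplier z) / (- c 0 * jost z (physical_multiplier z) 0)"
      using z Bl hFG resolvent_form_eq[OF f floquet_physical[OF off] norm_physical[OF off] nz, of g] by auto
    then show "D crossing_multiplier z * h z = N crossing_multiplier z"
      using nz by (simp add: D_def N_def eq)
  qed

  \<comment> \<open>In the lower half of \<open>Bl\<close>, \<open>h\<close> equals \<open>G\<close>
    and the crossing multiplier equals \<open>\<theta>'\<close>, so \<open>glue\<close> gives the
    seed. It spreads over the connected complement of the bands.\<close>
  have GND: "D \<theta>' z * G z = N \<theta>' z" if z: "z \<in> ?U - P" for z
  proof (rule holomorphic_eq_off_sparse[OF _ connected_Compl_sigma_ac P(1) _ _ _ _ _ z])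
    show "open ?U" using closed_sigma_ac by (simp add: open_Compl)
    show "(\<lambda>z. D \<theta>' z * G z) holomorphic_on ?U - P"
      by (intro holomorphic_on_mult hol P holomorphic_on_subset[OF \<theta>']) auto
    show "N \<theta>' holomorphic_on ?U - P"
      by (intro hol holomorphic_on_subset[OF \<theta>']) auto
    have low: "open ({z. Im z < 0} \<inter> Bl)" by (auto simp: Bl_def open_halfspace_Im_lt)
    have sp: "P' sparse_in {z. Im z < 0} \<inter> Bl"
      using sparse' by (rule sparse_in_subset) auto
    show "open ({z. Im z < 0} \<inter> Bl - P')"
      using low sp by (rule open_diff_sparse_pts)
    have "band_point - complex_of_real (\<rho> / 2) * \<i> \<in> {z. Im z < 0} \<inter> Bl"
      using \<rho> by (simp add: Bl_def dist_norm norm_mult band_point_def)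
    then obtain w where w: "w \<in> {z. Im z < 0} \<inter> Bl" by blast
    have "w islimpt {z. Im z < 0} \<inter> Bl" using w by (intro interior_limit_point) (simp only: interior_open[OF low])
    moreover have "\<not> w islimpt P'" using w P' Bl by auto
    ultimately have "\<not> {z. Im z < 0} \<inter> Bl \<subseteq> P'" using islimpt_subset by blast
    then show "({z. Im z < 0} \<inter> Bl - P') \<inter> ?U \<noteq> {}"
      by (force simp: sigma_ac_def)
    fix z assume "z \<in> ({z. Im z < 0} \<inter> Bl - P') \<inter> ?U - P"
    then have z: "Im z < 0" "z \<in> Bl" "z \<notin> P'" by auto
    have "crossing_multiplier z = \<theta>' z"
      unfolding \<theta>'_def using z Re_pos r' Bl by (intro crossing_lower) auto
    moreover have "h z = G z" using hFG z Bl by auto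
    ultimately show "D \<theta>' z * G z = N \<theta>' z"
      using glue[of z] z by (simp add: D_def N_def)
  qed

  \<comment> \<open>With a nonzero denominator at \<open>\<mu>\<close>, \<open>G\<close> has the
    finite limit \<open>N / D\<close> there, which contradicts the pole.\<close>
  have "jost \<mu> (\<theta>' \<mu>) 0 \<noteq> 0"
    using contra floquet_inverse[OF floquet_physical[OF \<mu>]] by (auto simp: \<theta>'_def)
  then have D\<mu>: "D \<theta>' \<mu> \<noteq> 0" by (simp add: D_def)
  have open_U: "open ?U" using closed_sigma_ac by (simp add: open_Compl)
  have cont: "isCont (N \<theta>') \<mu>" "isCont (D \<theta>') \<mu>"
    using hol[OF \<theta>'] open_U \<mu> by (auto intro!: continuous_on_interior holomorphic_on_imp_continuous_on simp: interior_open)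
  have lim: "((\<lambda>z. N \<theta>' z / D \<theta>' z) \<longlongrightarrow> N \<theta>' \<mu> / D \<theta>' \<mu>) (at \<mu>)"
    using cont D\<mu> by (intro tendsto_divide) (auto simp: isCont_def)
  have "\<forall>\<^sub>F z in at \<mu>. z \<in> ?U"
    using open_U \<mu> by (intro eventually_at_in_open') auto
  moreover have "\<forall>\<^sub>F z in at \<mu>. z \<notin> P"
    using P(1) \<mu> by (auto simp: sparse_in_def islimpt_iff_eventually)
  moreover have "\<forall>\<^sub>F z in at \<mu>. D \<theta>' z \<noteq> 0"
    using cont(2) D\<mu> by (auto simp: isCont_def intro: tendsto_imp_eventually_ne)
  ultimately have "\<forall>\<^sub>F z in at \<mu>. N \<theta>' z / D \<theta>' z = G z"
    by eventually_elim (use GND in \<open>auto simp: field_simps\<close>)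
  then have "(G \<longlongrightarrow> N \<theta>' \<mu> / D \<theta>' \<mu>) (at \<mu>)"
    using lim by (rule Lim_transform_eventually[rotated])
  then show False
    using not_tendsto_and_filterlim_at_infinity[OF _ _ pole] by simp
qed

end

section \<open>Choice of the threshold and exclusion of the three kinds of states\<close>

theorem theorem4:
  fixes v a :: real and p :: nat and q0 :: "nat \<Rightarrow> real"
  assumes "0 < a" and "a \<le> 2" and "1 \<le> p" and "\<forall>j\<in>{1..p}. q0 j \<noteq> 0"
  shows "\<forall>R>0. \<forall>\<epsilon>>0. \<exists>t0\<ge>1. \<forall>t>t0. \<forall>\<mu>.
           state_proj a v (pert p q0 t) \<mu> \<and> cmod \<mu> \<le> R \<longrightarrow>
           cmod (\<mu> - (-1)^p * complex_of_real v) < \<epsilon>"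
proof (intro allI impI)
  fix R \<epsilon> :: real assume "R > 0" "\<epsilon> > 0"
  have jac: "perturbed_jacobi a p (pert p q0 t)" for t
    using \<open>0 < a\<close> by unfold_locales (auto simp: pert_def)
  have lim_point: "complex_of_real (vcoef v (Suc p)) = (-1)^p * complex_of_real v"
    by (cases "even p") (auto simp: vcoef_def)
  define l where "l = complex_of_real (vcoef v (Suc p))"
  have norm_l: "norm l = \<bar>v\<bar>" by (simp add: l_def vcoef_def)
  define m where "m = perturbed_jacobi.band_point a v"
  have m: "Re m > \<bar>v\<bar>" "norm m = Re m"
    unfolding m_def by (rule perturbed_jacobi.Re_band_point[OF jac] perturbed_jacobi.norm_band_point[OF jac])+
  \<comment> \<open>At most half the distance from the band point to the circle of radius
    \<open>\<bar>v\<bar>\<close>, which contains \<open>l\<close>. The cap 1 matches the summand 1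
    in \<open>R'\<close>.\<close>
  define \<delta> where "\<delta> = min 1 ((norm m - \<bar>v\<bar>) / 2)"
  define R' where "R' = max R (norm m) + 1 + \<epsilon>"
  \<comment> \<open>A distance to \<open>l\<close> kept both on the ball of radius
    \<open>\<delta>\<close> around the band point and on the ball of radius
    \<open>\<epsilon> / 2\<close> around a \<open>\<mu>\<close> with distance at least
    \<open>\<epsilon>\<close> from \<open>l\<close>.\<close>
  define e where "e = min (\<epsilon> / 2) \<delta>"
  have pos: "\<delta> > 0" "e > 0" using m \<open>\<epsilon> > 0\<close> by (auto simp: \<delta>_def e_def)
  have "e \<le> \<delta>" "\<delta> \<le> (norm m - \<bar>v\<bar>) / 2"
    unfolding e_def \<delta>_def by (rule min.cobounded2)+
  define T where "T = R' + \<bar>v\<bar> + (1 + a) * (2 + (1 + a) * (1 + perturbed_jacobi.floquet_bound a v R') / e)"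
  \<comment> \<open>With the smallest unperturbed strength \<open>b\<close>,
    \<open>t > T / b\<close> lifts every perturbed site above \<open>T\<close>, the size required by
    \<open>norm_jost_0_ge\<close>.\<close>
  define b where "b = Min ((\<lambda>j. \<bar>q0 j\<bar>) ` {1..p})"
  have b: "b > 0" using assms(3,4) unfolding b_def by (subst Min_gr_iff) auto
  have b_le: "b \<le> \<bar>q0 j\<bar>" if "1 \<le> j" "j \<le> p" for j
    unfolding b_def using that by (intro Min_le) auto
  show "\<exists>t0\<ge>1. \<forall>t>t0. \<forall>\<mu>. state_proj a v (pert p q0 t) \<mu> \<and> cmod \<mu> \<le> R \<longrightarrow>
           cmod (\<mu> - (-1)^p * complex_of_real v) < \<epsilon>"
  proof (intro exI[of _ "max 1 (T / b)"] conjI allI impI)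
    fix t \<mu> assume t: "max 1 (T / b) < t"
      and st: "state_proj a v (pert p q0 t) \<mu> \<and> cmod \<mu> \<le> R"
    interpret perturbed_jacobi a v p "pert p q0 t" by (rule jac)
    have big: "T \<le> \<bar>pert p q0 t j\<bar>" if "1 \<le> j" "j \<le> p" for j
    proof -
      have "T \<le> t * b" using t b by (simp add: field_simps)
      also have "\<dots> \<le> t * \<bar>q0 j\<bar>" using t b_le[OF that] by (intro mult_left_mono) auto
      finally show ?thesis using that t by (simp add: pert_def abs_mult)
    qed
    have lower: "e \<le> norm (jost z \<theta> 0)" if "norm z \<le> R'" "e \<le> norm (z - l)" "floquet z \<theta>" for z \<theta>
      using that big pos unfolding l_def T_def
      by (intro norm_jost_0_ge[where K = "floquet_bound R'" and R = R'] norm_floquet_le) auto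
    have near_band: "jost z \<theta> 0 \<noteq> 0" if z: "z \<in> ball band_point \<delta>" "floquet z \<theta>" for z \<theta>
    proof -
      have zm: "norm (m - z) < \<delta>" using z by (simp add: m_def dist_norm)
      have "norm z \<le> norm m + norm (m - z)" by (metis norm_minus_commute norm_triangle_sub)
      then have "norm z \<le> R'" using zm \<open>\<epsilon> > 0\<close> unfolding R'_def \<delta>_def by linarith
      moreover have "norm m \<le> norm (m - z) + norm (z - l) + norm l"
        by (smt (verit) norm_triangle_sub norm_minus_commute)
      then have "e \<le> norm (z - l)"
        using zm \<open>e \<le> \<delta>\<close> \<open>\<delta> \<le> (norm m - \<bar>v\<bar>) / 2\<close> unfolding norm_l by argo
      ultimately show ?thesis using lower[of z \<theta>] z pos by auto
    qed
    show "cmod (\<mu> - (-1)^p * complex_of_real v) < \<epsilon>"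
    proof (rule ccontr)
      assume "\<not> ?thesis"
      then have far: "\<epsilon> \<le> norm (\<mu> - l)" by (simp add: l_def lim_point)
      \<comment> \<open>A whole ball around \<open>\<mu>\<close> is treated because excluding a
        virtual state takes a uniform bound near the edge. Eigenvalues and resonances use only the
        centre.\<close>
      have around: "e \<le> norm (jost z \<theta> 0)" if z: "z \<in> ball \<mu> (\<epsilon> / 2)" "floquet z \<theta>" for z \<theta>
      proof (rule lower[OF _ _ z(2)])
        have "norm (\<mu> - z) < \<epsilon> / 2" using z by (simp add: dist_norm)
        moreover have "norm z \<le> norm \<mu> + norm (\<mu> - z)" by (metis norm_minus_commute norm_triangle_sub)
        moreover have "norm (\<mu> - l) \<le> norm (\<mu> - z) + norm (z - l)"
          using norm_triangle_ineq[of "\<mu> - z" "z - l"] by simp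
        ultimately show "norm z \<le> R'" "e \<le> norm (z - l)"
          using st far \<open>\<epsilon> > 0\<close> unfolding R'_def e_def by linarith+
      qed
      have "\<mu> \<in> ball \<mu> (\<epsilon> / 2)" using \<open>\<epsilon> > 0\<close> by simp
      then have "\<not> (\<exists>\<theta>. floquet \<mu> \<theta> \<and> jost \<mu> \<theta> 0 = 0)"
        using around[of \<mu>] pos by force
      moreover have "\<not> virtual_state a v (pert p q0 t) \<mu>"
        using \<open>\<epsilon> > 0\<close> pos around by (intro not_virtual_state[of "\<epsilon> / 2" e]) auto
      ultimately show False
        using st eigenvalue_imp_jost_zero resonance_imp_jost_zero[OF _ pos(1) near_band]
        unfolding state_proj_def by blast
    qed
  qed simp
qed

end
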